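(* Let $\lambda<0$ and $\mu_1\in\mathbb{R}$ be real constants and let $n$ be an integer with $2\le n\le 4$. Then there exist a constant $L\ge -(n-1)/\lambda$ and a unique function $h\in C^2((0,L))\cap C^1([0,L))$ satisfying $$2r^2h(r)h_{rr}(r)=(n-1)h(r)(h(r)-1)+rh_r(r)\big(rh_r(r)-\lambda r-(n-1)\big),\qquad h(r)>0,\qquad \forall\, 0<r<L,$$ together with $h(0)=1$ and $h_r(0)=\mu_1$.
   Context: Functions are real-valued; $h_r$ and $h_{rr}$ denote the first and second derivatives of $h$ in $r$. $C^1([0,L))$ means continuously differentiable up to $r=0$, with $h_r(0)$ the one-sided derivative at $0$. Uniqueness is meant among functions in $C^2((0,L))\cap C^1([0,L))$ for that $L$. *)

theory Defs
  imports "HOL-Analysis.Analysis"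
begin

text \<open>
  k-times continuously differentiable real functions on an interval S. Derivatives are taken
  within S, so they are two-sided at interior points and one-sided at an endpoint belonging to S.
  Values of f outside S are irrelevant.
\<close>

primrec Ck_on :: "nat \<Rightarrow> real set \<Rightarrow> (real \<Rightarrow> real) \<Rightarrow> bool" where
  "Ck_on 0 S f \<longleftrightarrow> continuous_on S f"
| "Ck_on (Suc k) S f \<longleftrightarrow>
     (\<exists>f'. (\<forall>x\<in>S. (f has_real_derivative f' x) (at x within S)) \<and> Ck_on k S f')"

text \<open>
  On the open interval the library's total derivative operator agrees with the derivatives
  provided by the C2 condition; at 0 the derivative has to be taken one-sidedly.
\<close>

definition is_solution :: "real \<Rightarrow> real \<Rightarrow> int \<Rightarrow> real \<Rightarrow> (real \<Rightarrow> real) \<Rightarrow> bool" where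
  "is_solution lam mu1 n L h \<longleftrightarrow>
     Ck_on 2 {0<..<L} h \<and> Ck_on 1 {0..<L} h \<and>
     (\<forall>r\<in>{0<..<L}.
        2 * r\<^sup>2 * h r * deriv (deriv h) r =
          (of_int n - 1) * h r * (h r - 1)
          + r * deriv h r * (r * deriv h r - lam * r - (of_int n - 1)) \<and>
        h r > 0) \<and>
     h 0 = 1 \<and>
     (h has_real_derivative mu1) (at 0 within {0..<L})"

end

theory Submission
  imports Defs
begin

text \<open>
  Put m = n - 1, k = - lam and h = y^2. The equation becomes
  y'' = m (y^2 - 1) / (4 r^2 y) + y' (k r - m) / (2 r y^2), and with w = (y - 1) / r, z = y',
  p = z - w it is the system r w' = p, r p' = - (1 + m/2) p + r F(r, w, p) with F smooth where
  y > 0. Inverting the linear part turns this into a Volterra fixed point problem, which is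
  uniquely solvable on every [0, R], despite the singularity at 0, once F is made globally
  Lipschitz by clipping its arguments.

  It remains to find a priori bounds for R < L = m / k. For mu1 < 0 one has y < 1 and y' < 0,
  and E = y' - A (1 - y) / y with A = (m - k r) / (2 r) is increasing, since
  E' = m (1 - y)^2 / (4 r^2 y); hence E stays above its value (1 + m/2) mu1 / 2 at 0, which bounds
  y' from below and keeps y away from 0 as long as A > 0. For mu1 > 0 one has y > 1 and y' > 0,
  and y' stays below an exponential. Solutions for different R agree by uniqueness.
\<close>

section \<open>A singular first-order system\<close>

text \<open>The substitution h = y^2 is chosen because 2 h h'' - h'^2 = 4 y^3 y'', so the term
  quadratic in the slope disappears. At r = 0 the linear part of the system for (w, p) has exponents
  0 and -(1 + m/2): the first is the freely prescribed value w(0) = mu1 / 2, the second is excluded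
  by continuity at 0. This is why the initial slope alone singles out one solution.

  The obstacle is that F is only locally Lipschitz: y may reach 0, or w and z may become unbounded.
  Clipping separates the two difficulties. The singularity is handled once, for a globally Lipschitz
  problem, and a first-exit argument then shows that the clipping was never active. For this reason
  the a priori bounds are stated at a point r with information only strictly before r, and are
  strict or leave room to be made strict.

  The length m / k is where the coefficient k r - m of y' changes sign; the lower bound for y
  obtained when mu1 < 0 depends on A > 0 and so on staying below it.\<close>

lemma abs_le_of_deriv_bound:
  fixes f g :: "real \<Rightarrow> real"
  assumes "a \<le> b" "continuous_on {a..b} f" "continuous_on {a..b} g" "\<bar>f a\<bar> \<le> g a"
    and "\<And>x. a < x \<Longrightarrow> x < b \<Longrightarrow> (f has_real_derivative f' x) (at x)"
    and "\<And>x. a < x \<Longrightarrow> x < b \<Longrightarrow> (g has_real_derivative g' x) (at x)"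
    and "\<And>x. a < x \<Longrightarrow> x < b \<Longrightarrow> \<bar>f' x\<bar> \<le> g' x"
  shows "\<bar>f b\<bar> \<le> g b"
proof -
  have "(\<lambda>x. g x - f x) a \<le> (\<lambda>x. g x - f x) b"
    by (rule DERIV_nonneg_imp_increasing_open[OF assms(1)])
      (use assms(2,3,5-7) in \<open>force intro: DERIV_diff continuous_on_diff\<close>)+
  moreover have "(\<lambda>x. g x + f x) a \<le> (\<lambda>x. g x + f x) b"
    by (rule DERIV_nonneg_imp_increasing_open[OF assms(1)])
      (use assms(2,3,5-7) in \<open>force intro: DERIV_add continuous_on_add\<close>)+
  ultimately show ?thesis using assms(4) by auto
qed

text \<open>The forcing \<open>\<phi>\<close> is a separate argument, so that one predicate covers
  the linear problem, the nonlinear one with \<open>\<phi> r = G r (w r) (p r)\<close>, and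
  differences of solutions. For a > 0, continuity of p at 0 discards the homogeneous solution
  r^(-a).\<close>

definition sing_sys ::
    "real \<Rightarrow> real \<Rightarrow> (real \<Rightarrow> real) \<Rightarrow> (real \<Rightarrow> real) \<Rightarrow> (real \<Rightarrow> real) \<Rightarrow> bool" where
  "sing_sys a R \<phi> w p \<longleftrightarrow>
     continuous_on {0..R} w \<and> continuous_on {0..R} p \<and> p 0 = 0 \<and>
     (\<forall>r\<in>{0<..<R}. (w has_real_derivative p r / r) (at r) \<and>
        (p has_real_derivative \<phi> r - a * p r / r) (at r))"

section \<open>The linear problem: weighted estimates and solvability\<close>

lemma sing_sys_diff:
  assumes "sing_sys a R \<phi> w p" "sing_sys a R \<psi> v q"
  shows "sing_sys a R (\<lambda>r. \<phi> r - \<psi> r) (\<lambda>r. w r - v r) (\<lambda>r. p r - q r)"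
  using assms unfolding sing_sys_def
  by (auto intro!: continuous_intros derivative_eq_intros simp: diff_divide_distrib algebra_simps)

text \<open>Solving gains a factor 1/B against the weight exp (B r), as for a regular Volterra
  equation. The singular terms do not spoil this: they vanish from the derivatives of r^a p and of a
  w + p, which are r^a \<phi> and \<phi>.\<close>

lemma sing_sys_bound:
  assumes "sing_sys a R \<phi> w p" "w 0 = 0" "a > 0" "B > 0" "D \<ge> 0"
    and \<phi>: "\<And>r. 0 < r \<Longrightarrow> r < R \<Longrightarrow> \<bar>\<phi> r\<bar> \<le> D * exp (B * r)"
    and r: "0 \<le> r" "r \<le> R"
  shows "\<bar>p r\<bar> \<le> D * exp (B * r) / B" "\<bar>w r\<bar> \<le> 2 / a * (D * exp (B * r) / B)"
proof -
  have cw: "continuous_on {0..r} w" and cp: "continuous_on {0..r} p" and p0: "p 0 = 0"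
    using assms(1) r unfolding sing_sys_def by (auto intro: continuous_on_subset)
  have dw: "(w has_real_derivative p x / x) (at x)"
    and dp: "(p has_real_derivative \<phi> x - a * p x / x) (at x)" if "0 < x" "x < r" for x
    using assms(1) r that unfolding sing_sys_def by auto
  \<comment> \<open>The comparison function is the claimed bound times the integrating factor.
    Differentiating the power yields an extra nonnegative term, which only helps.\<close>
  have "\<bar>r powr a * p r\<bar> \<le> r powr a * (D * exp (B * r) / B)"
  proof (rule abs_le_of_deriv_bound[where a = 0 and b = r and f = "\<lambda>x. x powr a * p x"
        and g = "\<lambda>x. x powr a * (D * exp (B * x) / B)" and f' = "\<lambda>x. x powr a * \<phi> x"
        and g' = "\<lambda>x. x powr a * (D * exp (B * x)) + a * x powr (a - 1) * (D * exp (B * x) / B)"])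
    show "continuous_on {0..r} (\<lambda>x. x powr a * p x)"
      using \<open>a > 0\<close> by (intro continuous_intros continuous_on_powr' cp) auto
    show "continuous_on {0..r} (\<lambda>x. x powr a * (D * exp (B * x) / B))"
      using \<open>a > 0\<close> \<open>B > 0\<close> by (intro continuous_intros continuous_on_powr') auto
    fix x :: real assume x: "0 < x" "x < r"
    have *: "x powr (a - 1) * x = x powr a" "x powr a / x = x powr (a - 1)"
      using x by (simp_all add: powr_diff)
    show "((\<lambda>x. x powr a * p x) has_real_derivative x powr a * \<phi> x) (at x)"
      using x by (auto intro!: derivative_eq_intros dp simp: algebra_simps powr_diff)
    show "((\<lambda>x. x powr a * (D * exp (B * x) / B)) has_real_derivative
        x powr a * (D * exp (B * x)) + a * x powr (a - 1) * (D * exp (B * x) / B)) (at x)"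
      using x \<open>B > 0\<close> by (auto intro!: derivative_eq_intros simp: field_simps)
    have "\<bar>x powr a * \<phi> x\<bar> \<le> x powr a * (D * exp (B * x))"
      using \<phi>[of x] x r by (simp add: abs_mult mult_left_mono)
    also have "\<dots> \<le> x powr a * (D * exp (B * x)) + a * x powr (a - 1) * (D * exp (B * x) / B)"
      using assms by simp
    finally show "\<bar>x powr a * \<phi> x\<bar> \<le> \<dots>" .
  qed (use r in auto)
  hence *: "r powr a * \<bar>p r\<bar> \<le> r powr a * (D * exp (B * r) / B)"
    by (simp add: abs_mult)
  show pr: "\<bar>p r\<bar> \<le> D * exp (B * r) / B"
  proof (cases "r = 0")
    case True then show ?thesis using p0 assms by simp
  next
    case False
    with r have "r powr a > 0" by simp
    with * show ?thesis using mult_le_cancel_left_pos by blast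
  qed
  \<comment> \<open>In this combination the two terms a p / x cancel, so w is estimated without
    integrating p / x.\<close>
  have "\<bar>a * w r + p r\<bar> \<le> D * exp (B * r) / B"
  proof (rule abs_le_of_deriv_bound[where a = 0 and b = r and f = "\<lambda>x. a * w x + p x"
        and g = "\<lambda>x. D * exp (B * x) / B" and f' = "\<lambda>x. \<phi> x" and g' = "\<lambda>x. D * exp (B * x)"])
    fix x :: real assume x: "0 < x" "x < r"
    show "((\<lambda>x. a * w x + p x) has_real_derivative \<phi> x) (at x)"
      using x by (auto intro!: derivative_eq_intros dw dp)
    show "((\<lambda>x. D * exp (B * x) / B) has_real_derivative D * exp (B * x)) (at x)"
      using \<open>B > 0\<close> by (auto intro!: derivative_eq_intros)
    show "\<bar>\<phi> x\<bar> \<le> D * exp (B * x)" using \<phi> x r by simp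
  qed (use r assms p0 in \<open>auto intro!: continuous_intros cw cp\<close>)
  hence "a * \<bar>w r\<bar> \<le> 2 * (D * exp (B * r) / B)"
    using pr \<open>a > 0\<close> by (simp add: abs_if split: if_splits)
  thus "\<bar>w r\<bar> \<le> 2 / a * (D * exp (B * r) / B)"
    using \<open>a > 0\<close> pos_le_divide_eq[of a "\<bar>w r\<bar>" "2 * (D * exp (B * r) / B)"]
    by (simp add: mult.commute)
qed

text \<open>Variation of constants gives p as r^(-a) times the integral of s^a \<phi>. Since (a w +
  p)' = \<phi>, the formula for w needs only the integral of \<phi> and p itself, not the integral
  of p / s.\<close>

lemma sing_sys_exists:
  assumes \<phi>: "continuous_on {0..R} \<phi>" and "a > 0" "R > 0"
  shows "\<exists>w p. sing_sys a R \<phi> w p \<and> w 0 = \<mu>"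
proof -
  define J where "J r = integral {0..r} (\<lambda>s. s powr a * \<phi> s)" for r
  define I where "I r = integral {0..r} \<phi>" for r
  define p where "p r = r powr (-a) * J r" for r
  define w where "w r = \<mu> + (I r - p r) / a" for r
  have c: "continuous_on {0..R} (\<lambda>s. s powr a * \<phi> s)"
    using \<open>a > 0\<close> by (intro continuous_intros continuous_on_powr' \<phi>) auto
  have dJ: "(J has_real_derivative r powr a * \<phi> r) (at r within {0..R})" if "r \<in> {0..R}" for r
    unfolding J_def by (rule integral_has_real_derivative[OF c that])
  have dI: "(I has_real_derivative \<phi> r) (at r within {0..R})" if "r \<in> {0..R}" for r
    unfolding I_def by (rule integral_has_real_derivative[OF \<phi> that])
  have cJ: "continuous_on {0..R} J" and cI: "continuous_on {0..R} I"
    using DERIV_continuous_on[OF dJ] DERIV_continuous_on[OF dI] by auto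
  have dJ': "(J has_real_derivative r powr a * \<phi> r) (at r)"
    and dI': "(I has_real_derivative \<phi> r) (at r)" if "r \<in> {0<..<R}" for r
    using dJ[of r] dI[of r] that at_within_Icc_at[of 0 r R] by auto
  obtain M where M: "\<And>r. r \<in> {0..R} \<Longrightarrow> \<bar>\<phi> r\<bar> \<le> M"
    using compact_imp_bounded[OF compact_continuous_image[OF \<phi> compact_Icc]]
    unfolding bounded_iff by (metis image_eqI real_norm_def)
  have "M \<ge> 0" using M[of 0] \<open>R > 0\<close> by auto
  have pM: "\<bar>p r\<bar> \<le> M * r" if r: "0 < r" "r \<le> R" for r
  proof -
    have "\<bar>J r\<bar> \<le> M * (r * r powr a)"
    proof (rule abs_le_of_deriv_bound[where a = 0 and b = r and f = J
          and g = "\<lambda>x. M * (x * x powr a)" and f' = "\<lambda>x. x powr a * \<phi> x"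
          and g' = "\<lambda>x. M * ((1 + a) * x powr a)"])
      show "continuous_on {0..r} J" using cJ r by (auto intro: continuous_on_subset)
      show "continuous_on {0..r} (\<lambda>x. M * (x * x powr a))"
        using \<open>a > 0\<close> by (intro continuous_intros continuous_on_powr') auto
      fix x :: real assume x: "0 < x" "x < r"
      show "(J has_real_derivative x powr a * \<phi> x) (at x)" using dJ' x r by auto
      show "((\<lambda>x. M * (x * x powr a)) has_real_derivative M * ((1 + a) * x powr a)) (at x)"
        using x by (auto intro!: derivative_eq_intros simp: powr_diff algebra_simps)
      have "\<bar>x powr a * \<phi> x\<bar> \<le> x powr a * M"
        using M[of x] x r by (simp add: abs_mult mult_left_mono)
      also have "\<dots> \<le> M * ((1 + a) * x powr a)"
        using \<open>M \<ge> 0\<close> \<open>a > 0\<close> by (simp add: algebra_simps)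
      finally show "\<bar>x powr a * \<phi> x\<bar> \<le> \<dots>" .
    qed (use r in \<open>auto simp: J_def\<close>)
    hence "r powr (-a) * \<bar>J r\<bar> \<le> r powr (-a) * (M * (r * r powr a))"
      by (intro mult_left_mono) auto
    thus ?thesis using r by (simp add: p_def abs_mult powr_minus field_simps)
  qed
  \<comment> \<open>This holds by the convention \<open>0 powr (- a) = 0\<close>; it is the correct
    continuous value because of the bound M r just proved.\<close>
  have p0: "p 0 = 0" by (simp add: p_def)
  have cp: "continuous_on {0..R} p"
  proof (rule continuous_on_eq_continuous_within[THEN iffD2], rule ballI)
    fix r assume r: "r \<in> {0..R}"
    show "continuous (at r within {0..R}) p"
    proof (cases "r = 0")
      case True
      have "(p \<longlongrightarrow> 0) (at 0 within {0..R})"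
      proof (rule Lim_null_comparison)
        show "\<forall>\<^sub>F x in at 0 within {0..R}. norm (p x) \<le> M * x"
          unfolding eventually_at_filter using pM by (intro always_eventually) auto
        show "((\<lambda>x. M * x) \<longlongrightarrow> 0) (at 0 within {0..R})"
          by (auto intro!: tendsto_eq_intros)
      qed
      then show ?thesis using True p0 by (simp add: continuous_within)
    next
      case False
      have "continuous (at r within {0..R}) J"
        using cJ r continuous_on_eq_continuous_within by blast
      with False show ?thesis unfolding p_def continuous_within
        by (intro tendsto_mult tendsto_powr tendsto_const tendsto_ident_at) auto
    qed
  qed
  have dp: "(p has_real_derivative \<phi> r - a * p r / r) (at r)" if "r \<in> {0<..<R}" for r
    unfolding p_def using that
    by (auto intro!: derivative_eq_intros dJ' simp: powr_diff powr_minus field_simps)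
  have dw: "(w has_real_derivative p r / r) (at r)" if "r \<in> {0<..<R}" for r
    unfolding w_def using that \<open>a > 0\<close>
    by (auto intro!: derivative_eq_intros dp dI' simp: field_simps)
  have "continuous_on {0..R} w"
    unfolding w_def using \<open>a > 0\<close> by (auto intro!: continuous_intros cI cp)
  moreover have "w 0 = \<mu>" by (simp add: w_def p0 I_def)
  ultimately show ?thesis unfolding sing_sys_def using cp p0 dp dw by blast
qed

text \<open>Banach's theorem is applied to the weighted forcing Q, not to (w, p): a forcing is sent
  to the weighted value of G along the linear solution that it generates. Forcings need only be
  bounded and continuous, so they form a complete space; the initial conditions are built into the
  linear solution.\<close>

lemma sing_sys_fixpoint:
  assumes "a > 0" "R > 0" "K \<ge> 0"
    and lip: "\<And>r w p v q. r \<in> {0..R} \<Longrightarrow> \<bar>G r w p - G r v q\<bar> \<le> K * (\<bar>w - v\<bar> + \<bar>p - q\<bar>)"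
    and cont: "\<And>w p. continuous_on {0..R} w \<Longrightarrow> continuous_on {0..R} p \<Longrightarrow>
       continuous_on {0..R} (\<lambda>r. G r (w r) (p r))"
  shows "\<exists>w p. sing_sys a R (\<lambda>r. G r (w r) (p r)) w p \<and> w 0 = \<mu>"
proof -
  \<comment> \<open>The weighted distance in p is at most 1/B times that of the forcings, the one in
    w at most 2/a times as much; with the Lipschitz constant K the map contracts by C / B. The
    choice of B makes this less than 1 and keeps B positive when C = 0.\<close>
  define C where "C = K * (1 + 2 / a)"
  define B where "B = 2 * C + 1"
  have "C \<ge> 0" using assms by (simp add: C_def)
  hence "B > 0" by (simp add: B_def)
  have "\<exists>w p. sing_sys a R (\<lambda>r. exp (B * r) * apply_bcontfun Q r) w p \<and> w 0 = \<mu>"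
    for Q :: "real \<Rightarrow>\<^sub>C real"
    using assms by (intro sing_sys_exists continuous_intros) auto
  then obtain W P where WP: "\<And>Q. sing_sys a R (\<lambda>r. exp (B * r) * apply_bcontfun Q r) (W Q) (P Q)"
      and W0: "\<And>Q. W Q 0 = \<mu>"
    by metis
  \<comment> \<open>Composition with \<open>clamp\<close> extends the function constantly beyond
    [0, R], which makes it a bounded continuous function on the whole line.\<close>
  have "\<exists>H. (\<forall>x. apply_bcontfun H x = exp (- B * clamp 0 R x) *
      G (clamp 0 R x) (W Q (clamp 0 R x)) (P Q (clamp 0 R x)))" for Q
  proof -
    have "continuous_on (cbox 0 R) (\<lambda>r. exp (- B * r) * G r (W Q r) (P Q r))"
      using WP[of Q] unfolding sing_sys_def by (auto intro!: continuous_intros cont)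
    from continuous_on_cbox_bcontfunE[OF this] show ?thesis by metis
  qed
  then obtain T where T: "\<And>Q x. apply_bcontfun (T Q) x = exp (- B * clamp 0 R x) *
      G (clamp 0 R x) (W Q (clamp 0 R x)) (P Q (clamp 0 R x))"
    by metis
  have contr: "dist (T Q) (T S) \<le> C / B * dist Q S" for Q S
  proof (rule dist_bound)
    fix x
    define r where "r = clamp 0 R x"
    have r: "r \<in> {0..R}" using clamp_in_interval[of 0 R x] \<open>R > 0\<close> by (simp add: r_def)
    define D where "D = dist Q S"
    have est: "\<bar>P Q r - P S r\<bar> \<le> D * exp (B * r) / B"
        "\<bar>W Q r - W S r\<bar> \<le> 2 / a * (D * exp (B * r) / B)"
    proof -
      have *: "\<bar>exp (B * s) * Q s - exp (B * s) * S s\<bar> \<le> D * exp (B * s)" for s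
        using dist_bounded[of Q s S]
        by (simp add: D_def dist_real_def right_diff_distrib[symmetric] abs_mult)
      show "\<bar>P Q r - P S r\<bar> \<le> D * exp (B * r) / B"
        "\<bar>W Q r - W S r\<bar> \<le> 2 / a * (D * exp (B * r) / B)"
        using sing_sys_bound[OF sing_sys_diff[OF WP[of Q] WP[of S]] _ \<open>a > 0\<close> \<open>B > 0\<close>, of D r] * r
        by (auto simp: W0 D_def)
    qed
    have "dist (T Q x) (T S x) = exp (- B * r) * \<bar>G r (W Q r) (P Q r) - G r (W S r) (P S r)\<bar>"
      by (simp add: T r_def[symmetric] dist_real_def right_diff_distrib[symmetric] abs_mult)
    also have "\<dots> \<le> exp (- B * r) * (K * (\<bar>W Q r - W S r\<bar> + \<bar>P Q r - P S r\<bar>))"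
      using lip[OF r] by (intro mult_left_mono) auto
    also have "\<dots> \<le> exp (- B * r) * (K * (2 / a * (D * exp (B * r) / B) + D * exp (B * r) / B))"
      using est \<open>K \<ge> 0\<close> by (intro mult_left_mono add_mono) auto
    also have "\<dots> = C / B * D * (exp (- B * r) * exp (B * r))"
      by (simp add: C_def algebra_simps add_divide_distrib)
    also have "\<dots> = C / B * D" by (simp add: exp_minus)
    finally show "dist (T Q x) (T S x) \<le> C / B * dist Q S" by (simp add: D_def)
  qed
  have "C / B < 1" "C / B \<ge> 0" using \<open>C \<ge> 0\<close> \<open>B > 0\<close> by (simp_all add: B_def field_simps)
  then obtain Q where Q: "T Q = Q"
    using banach_fix_type[of "C / B" T] contr by blast
  have "exp (B * r) * Q r = G r (W Q r) (P Q r)" if "r \<in> {0..R}" for r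
  proof -
    have "clamp 0 R r = r" using that by simp
    hence "Q r = exp (- B * r) * G r (W Q r) (P Q r)" using T[of Q r] Q by simp
    thus ?thesis by (simp add: exp_minus)
  qed
  hence "sing_sys a R (\<lambda>r. G r (W Q r) (P Q r)) (W Q) (P Q)"
    using WP[of Q] unfolding sing_sys_def by auto
  thus ?thesis using W0 by blast
qed

text \<open>With D the maximum of the weighted difference, the linear estimate gives D \<le> (C / B)
  D with C / B < 1, hence D = 0. The Lipschitz bound is asked only along the two given solutions, so
  the lemma also serves nonlinearities that are not globally Lipschitz.\<close>

lemma sing_sys_unique:
  assumes "a > 0" "R > 0" "K \<ge> 0"
    and lip: "\<And>r. r \<in> {0..R} \<Longrightarrow> \<bar>\<phi> r - \<psi> r\<bar> \<le> K * (\<bar>w r - v r\<bar> + \<bar>p r - q r\<bar>)"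
    and 1: "sing_sys a R \<phi> w p" and 2: "sing_sys a R \<psi> v q" and 0: "w 0 = v 0"
    and r: "r \<in> {0..R}"
  shows "w r = v r" "p r = q r"
proof -
  define C where "C = K * (1 + 2 / a)"
  define B where "B = 2 * C + 1"
  have "C \<ge> 0" using assms by (simp add: C_def)
  hence "B > 0" by (simp add: B_def)
  let ?d = "\<lambda>r. \<bar>w r - v r\<bar> + \<bar>p r - q r\<bar>"
  have "continuous_on {0..R} (\<lambda>r. exp (- B * r) * ?d r)"
    using 1 2 unfolding sing_sys_def by (auto intro!: continuous_intros)
  from continuous_attains_sup[OF compact_Icc _ this] obtain x where x: "x \<in> {0..R}"
    and max: "\<And>s. s \<in> {0..R} \<Longrightarrow> exp (- B * s) * ?d s \<le> exp (- B * x) * ?d x"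
    using \<open>R > 0\<close> by (metis atLeastAtMost_iff empty_iff less_eq_real_def order_refl)
  define D where "D = exp (- B * x) * ?d x"
  have D: "?d s \<le> D * exp (B * s)" if "s \<in> {0..R}" for s
    using max[OF that] by (simp add: D_def exp_minus field_simps)
  have "D \<ge> 0" by (simp add: D_def)
  have *: "\<bar>\<phi> s - \<psi> s\<bar> \<le> K * D * exp (B * s)" if "0 < s" "s < R" for s
    using lip[of s] mult_left_mono[OF D[of s] \<open>K \<ge> 0\<close>] that by (simp add: mult.assoc)
  note est = sing_sys_bound[OF sing_sys_diff[OF 1 2] _ \<open>a > 0\<close> \<open>B > 0\<close> _ *, of x]
  have "?d x \<le> 2 / a * (K * D * exp (B * x) / B) + K * D * exp (B * x) / B"
    using est x 0 \<open>K \<ge> 0\<close> \<open>D \<ge> 0\<close> by (intro add_mono) auto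
  hence "D \<le> exp (- B * x) * (2 / a * (K * D * exp (B * x) / B) + K * D * exp (B * x) / B)"
    unfolding D_def by (intro mult_left_mono) auto
  also have "\<dots> = C / B * D * (exp (- B * x) * exp (B * x))"
    by (simp add: C_def algebra_simps add_divide_distrib)
  also have "\<dots> = C / B * D" by (simp add: exp_minus)
  finally have "D * B \<le> C * D" using \<open>B > 0\<close> by (simp add: field_simps)
  hence "D * (C + 1) \<le> 0" by (simp add: B_def algebra_simps)
  hence "D \<le> 0" using \<open>C \<ge> 0\<close> by (simp add: mult_le_0_iff)
  with D[OF r] \<open>D \<ge> 0\<close> show "w r = v r" "p r = q r" by auto
qed

section \<open>Clipped nonlinearity\<close>

text \<open>Boundedness is carried along with the Lipschitz estimate because it is what makes the
  class closed under products.\<close>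

definition lip_bdd :: "real \<Rightarrow> (real \<Rightarrow> real \<Rightarrow> real \<Rightarrow> real) \<Rightarrow> bool" where
  "lip_bdd R f \<longleftrightarrow> (\<exists>C K. 0 \<le> C \<and> 0 \<le> K \<and> (\<forall>r\<in>{0..R}. \<forall>w p v q.
     \<bar>f r w p\<bar> \<le> C \<and> \<bar>f r w p - f r v q\<bar> \<le> K * (\<bar>w - v\<bar> + \<bar>p - q\<bar>)))"

lemma lip_bdd_const: "lip_bdd R (\<lambda>r w p. c)"
  unfolding lip_bdd_def by (rule exI[of _ "\<bar>c\<bar>"], rule exI[of _ 0]) auto

lemma lip_bdd_add:
  assumes "lip_bdd R f" "lip_bdd R g"
  shows "lip_bdd R (\<lambda>r w p. f r w p + g r w p)"
proof -
  obtain C K where 1: "0 \<le> C" "0 \<le> K" "\<And>r w p. r \<in> {0..R} \<Longrightarrow> \<bar>f r w p\<bar> \<le> C"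
    "\<And>r w p v q. r \<in> {0..R} \<Longrightarrow> \<bar>f r w p - f r v q\<bar> \<le> K * (\<bar>w - v\<bar> + \<bar>p - q\<bar>)"
    using assms(1) unfolding lip_bdd_def by blast
  obtain D M where 2: "0 \<le> D" "0 \<le> M" "\<And>r w p. r \<in> {0..R} \<Longrightarrow> \<bar>g r w p\<bar> \<le> D"
    "\<And>r w p v q. r \<in> {0..R} \<Longrightarrow> \<bar>g r w p - g r v q\<bar> \<le> M * (\<bar>w - v\<bar> + \<bar>p - q\<bar>)"
    using assms(2) unfolding lip_bdd_def by blast
  show ?thesis unfolding lip_bdd_def
  proof (rule exI[of _ "C + D"], rule exI[of _ "K + M"], intro conjI ballI allI)
    fix r w p v q :: real assume r: "r \<in> {0..R}"
    show "\<bar>f r w p + g r w p\<bar> \<le> C + D" using 1(3)[OF r, of w p] 2(3)[OF r, of w p] by linarith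
    show "\<bar>f r w p + g r w p - (f r v q + g r v q)\<bar> \<le> (K + M) * (\<bar>w - v\<bar> + \<bar>p - q\<bar>)"
      using 1(4)[OF r, of w p v q] 2(4)[OF r, of w p v q] unfolding distrib_right by linarith
  qed (use 1 2 in auto)
qed

lemma lip_bdd_mult:
  assumes "lip_bdd R f" "lip_bdd R g"
  shows "lip_bdd R (\<lambda>r w p. f r w p * g r w p)"
proof -
  obtain C K where 1: "0 \<le> C" "0 \<le> K" "\<And>r w p. r \<in> {0..R} \<Longrightarrow> \<bar>f r w p\<bar> \<le> C"
    "\<And>r w p v q. r \<in> {0..R} \<Longrightarrow> \<bar>f r w p - f r v q\<bar> \<le> K * (\<bar>w - v\<bar> + \<bar>p - q\<bar>)"
    using assms(1) unfolding lip_bdd_def by blast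
  obtain D M where 2: "0 \<le> D" "0 \<le> M" "\<And>r w p. r \<in> {0..R} \<Longrightarrow> \<bar>g r w p\<bar> \<le> D"
    "\<And>r w p v q. r \<in> {0..R} \<Longrightarrow> \<bar>g r w p - g r v q\<bar> \<le> M * (\<bar>w - v\<bar> + \<bar>p - q\<bar>)"
    using assms(2) unfolding lip_bdd_def by blast
  show ?thesis unfolding lip_bdd_def
  proof (rule exI[of _ "C * D"], rule exI[of _ "C * M + K * D"], intro conjI ballI allI)
    fix r w p v q :: real assume r: "r \<in> {0..R}"
    let ?s = "\<bar>w - v\<bar> + \<bar>p - q\<bar>"
    show "\<bar>f r w p * g r w p\<bar> \<le> C * D"
      unfolding abs_mult using 1 2 r by (intro mult_mono) auto
    have "f r w p * g r w p - f r v q * g r v q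
        = f r w p * (g r w p - g r v q) + (f r w p - f r v q) * g r v q"
      by (simp add: algebra_simps)
    also have "\<bar>\<dots>\<bar> \<le> \<bar>f r w p\<bar> * \<bar>g r w p - g r v q\<bar> + \<bar>f r w p - f r v q\<bar> * \<bar>g r v q\<bar>"
      unfolding abs_mult[symmetric] by (rule abs_triangle_ineq)
    also have "\<dots> \<le> C * (M * ?s) + (K * ?s) * D"
      using 1 2 r by (intro add_mono mult_mono) auto
    also have "\<dots> = (C * M + K * D) * ?s" by (simp add: algebra_simps)
    finally show "\<bar>f r w p * g r w p - f r v q * g r v q\<bar> \<le> (C * M + K * D) * ?s" .
  qed (use 1 2 in auto)
qed

definition clip :: "real \<Rightarrow> real \<Rightarrow> real" where
  "clip M x = max (- M) (min M x)"

lemma clip_id: "\<bar>x\<bar> \<le> M \<Longrightarrow> clip M x = x"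
  by (auto simp: clip_def)

lemma lip_bdd_clip:
  assumes "M \<ge> 0"
  shows "lip_bdd R (\<lambda>r w p. clip M w)" "lip_bdd R (\<lambda>r w p. clip M (w + p))"
proof -
  have *: "\<bar>clip M x\<bar> \<le> M" "\<bar>clip M x - clip M y\<bar> \<le> \<bar>x - y\<bar>" for x y
    using assms by (auto simp: clip_def)
  show "lip_bdd R (\<lambda>r w p. clip M w)"
    unfolding lip_bdd_def using assms *(1)
    by - (rule exI[of _ M], rule exI[of _ 1], auto intro: order_trans[OF *(2)])
  show "lip_bdd R (\<lambda>r w p. clip M (w + p))"
    unfolding lip_bdd_def using assms *(1)
    by - (rule exI[of _ M], rule exI[of _ 1], auto intro: order_trans[OF *(2)])
qed

text \<open>The floor \<open>\<delta>\<close> bounds the reciprocal, and r \<le> R turns the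
  Lipschitz dependence on y = 1 + r w into one on w.\<close>

lemma lip_bdd_inverse_max:
  assumes "\<delta> > 0" "R \<ge> 0"
  shows "lip_bdd R (\<lambda>r w p. inverse (max \<delta> (1 + r * w)))"
proof -
  have 1: "\<bar>inverse (max \<delta> x)\<bar> \<le> inverse \<delta>" for x
    using assms by (auto simp: le_imp_inverse_le)
  have 2: "\<bar>inverse (max \<delta> (1 + r * w)) - inverse (max \<delta> (1 + r * v))\<bar> \<le>
      inverse \<delta> * inverse \<delta> * R * (\<bar>w - v\<bar> + \<bar>p - q\<bar>)" if r: "r \<in> {0..R}" for r w v p q
  proof -
    let ?x = "max \<delta> (1 + r * w)" and ?y = "max \<delta> (1 + r * v)"
    have "inverse ?x - inverse ?y = inverse ?x * (?y - ?x) * inverse ?y"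
      using assms by (subst inverse_diff_inverse) (auto simp: algebra_simps)
    also have "\<bar>\<dots>\<bar> = \<bar>inverse ?x\<bar> * \<bar>?y - ?x\<bar> * \<bar>inverse ?y\<bar>" by (simp only: abs_mult)
    also have "\<dots> \<le> inverse \<delta> * (R * (\<bar>w - v\<bar> + \<bar>p - q\<bar>)) * inverse \<delta>"
    proof (intro mult_mono 1)
      have "\<bar>?y - ?x\<bar> \<le> \<bar>r * v - r * w\<bar>" by auto
      also have "\<dots> = r * \<bar>w - v\<bar>" using r
        by (simp add: right_diff_distrib[symmetric] abs_mult abs_minus_commute)
      also have "\<dots> \<le> R * (\<bar>w - v\<bar> + \<bar>p - q\<bar>)" using r by (intro mult_mono) auto
      finally show "\<bar>?y - ?x\<bar> \<le> R * (\<bar>w - v\<bar> + \<bar>p - q\<bar>)" .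
    qed (use assms in auto)
    finally show ?thesis by (simp add: mult_ac)
  qed
  show ?thesis unfolding lip_bdd_def
    using 1 2 assms
    by - (rule exI[of _ "inverse \<delta>"], rule exI[of _ "inverse \<delta> * inverse \<delta> * R"], auto)
qed

section \<open>The nonlinearity with clipped arguments\<close>

text \<open>The function F of the introduction, with z = w + p.\<close>

definition reduced_rhs :: "real \<Rightarrow> real \<Rightarrow> real \<Rightarrow> real \<Rightarrow> real \<Rightarrow> real" where
  "reduced_rhs m k y w z = - (m / 4) * (w * w * inverse y)
     + m / 2 * (z * w * (inverse y + inverse y * inverse y)) + k / 2 * (z * (inverse y * inverse y))"

text \<open>The second clipped quantity is z = w + p and not p, because z is what the a priori
  bounds control.\<close>

definition clipped_rhs :: "real \<Rightarrow> real \<Rightarrow> real \<Rightarrow> real \<Rightarrow> real \<Rightarrow> real \<Rightarrow> real \<Rightarrow> real" where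
  "clipped_rhs m k \<delta> M r w p = reduced_rhs m k (max \<delta> (1 + r * w)) (clip M w) (clip M (w + p))"

lemma clipped_rhs_eq:
  "\<delta> \<le> 1 + r * w \<Longrightarrow> \<bar>w\<bar> \<le> M \<Longrightarrow> \<bar>w + p\<bar> \<le> M \<Longrightarrow>
    clipped_rhs m k \<delta> M r w p = reduced_rhs m k (1 + r * w) w (w + p)"
  by (simp add: clipped_rhs_def clip_id max_absorb2)

lemma clipped_rhs_lipschitz:
  assumes "\<delta> > 0" "M \<ge> 0" "R \<ge> 0"
  obtains K where "K \<ge> 0" "\<And>r w p v q. r \<in> {0..R} \<Longrightarrow>
    \<bar>clipped_rhs m k \<delta> M r w p - clipped_rhs m k \<delta> M r v q\<bar> \<le> K * (\<bar>w - v\<bar> + \<bar>p - q\<bar>)"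
proof -
  have "lip_bdd R (clipped_rhs m k \<delta> M)"
    unfolding clipped_rhs_def reduced_rhs_def
    by (intro lip_bdd_add lip_bdd_mult lip_bdd_const lip_bdd_clip lip_bdd_inverse_max assms)
  thus thesis unfolding lip_bdd_def using that by blast
qed

lemma clipped_rhs_continuous:
  assumes "\<delta> > 0" "continuous_on S w" "continuous_on S p"
  shows "continuous_on S (\<lambda>r. clipped_rhs m k \<delta> M r (w r) (p r))"
  unfolding clipped_rhs_def reduced_rhs_def clip_def using assms
  by (intro continuous_intros) (auto simp: max_def)

lemma clipped_rhs_solution_exists:
  assumes "\<delta> > 0" "M \<ge> 0" "R > 0" "a > 0"
  shows "\<exists>w p. sing_sys a R (\<lambda>r. clipped_rhs m k \<delta> M r (w r) (p r)) w p \<and> w 0 = \<mu>"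
proof -
  obtain K where "K \<ge> 0" "\<And>r w p v q. r \<in> {0..R} \<Longrightarrow>
    \<bar>clipped_rhs m k \<delta> M r w p - clipped_rhs m k \<delta> M r v q\<bar> \<le> K * (\<bar>w - v\<bar> + \<bar>p - q\<bar>)"
    using clipped_rhs_lipschitz assms by (metis less_imp_le)
  thus ?thesis using assms clipped_rhs_continuous by (intro sing_sys_fixpoint) auto
qed

section \<open>The equation for the square root\<close>

definition accel :: "real \<Rightarrow> real \<Rightarrow> real \<Rightarrow> real \<Rightarrow> real \<Rightarrow> real" where
  "accel m k r y z = m * (y\<^sup>2 - 1) / (4 * r\<^sup>2 * y) + z * (k * r - m) / (2 * r * y\<^sup>2)"

text \<open>The singular part is frozen at y = 1. The remainder is regular since 1 - 1/y = r w / y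
  and 1 - 1/y^2 = r w (1/y + 1/y^2), so that each leftover 1/r is cancelled.\<close>

lemma accel_eq_reduced_rhs:
  assumes "r > 0" "1 + r * w > 0"
  shows "accel m k r (1 + r * w) z = reduced_rhs m k (1 + r * w) w z - m / 2 * (z - w) / r"
proof -
  define y where "y = 1 + r * w"
  have w: "w = (y - 1) / r" using assms by (simp add: y_def)
  have "y > 0" using assms by (simp add: y_def)
  show ?thesis unfolding y_def[symmetric] unfolding accel_def reduced_rhs_def w
    using \<open>r > 0\<close> \<open>y > 0\<close> by (simp add: field_simps power2_eq_square)
qed

text \<open>A second splitting, for the barrier argument: keeping 1/y^2 in the singular coefficient
  leaves w - z as the only factor of variable sign there, and y^2 + y - 2 = (y - 1) (y + 2) makes
  the rest quadratic in w.\<close>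

lemma accel_expand:
  assumes "r > 0" "1 + r * w > 0"
  shows "accel m k r (1 + r * w) z = m / (2 * r * (1 + r * w)\<^sup>2) * (w - z)
    + m / 4 * w\<^sup>2 * (1 + r * w + 2) / (1 + r * w)\<^sup>2 + k * z / (2 * (1 + r * w)\<^sup>2)"
proof -
  define y where "y = 1 + r * w"
  have w: "w = (y - 1) / r" using assms by (simp add: y_def)
  have "y > 0" using assms by (simp add: y_def)
  show ?thesis unfolding y_def[symmetric] unfolding accel_def w
    using \<open>r > 0\<close> \<open>y > 0\<close> by (simp add: field_simps power2_eq_square)
qed

text \<open>The initial slope enters as the value at 0 of the continuous function z; the one-sided
  derivative of y is then a consequence. The interval is open on the right so that solutions can be
  glued.\<close>

definition profile :: "real \<Rightarrow> real \<Rightarrow> real \<Rightarrow> real \<Rightarrow> (real \<Rightarrow> real) \<Rightarrow> (real \<Rightarrow> real) \<Rightarrow> bool" where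
  "profile m k \<mu> R y z \<longleftrightarrow> y 0 = 1 \<and> z 0 = \<mu> \<and>
     continuous_on {0..<R} y \<and> continuous_on {0..<R} z \<and>
     (\<forall>r\<in>{0<..<R}. y r > 0 \<and> (y has_real_derivative z r) (at r) \<and>
        (z has_real_derivative accel m k r (y r) (z r)) (at r))"

section \<open>Passage to the singular system, and uniqueness\<close>

lemma profile_mono: "profile m k \<mu> R y z \<Longrightarrow> S \<le> R \<Longrightarrow> profile m k \<mu> S y z"
  unfolding profile_def by (auto intro: continuous_on_subset)

lemma right_derivative_at_0:
  fixes y z :: "real \<Rightarrow> real"
  assumes "R > 0" "continuous_on {0..<R} y" "continuous_on {0..<R} z"
    and d: "\<And>r. 0 < r \<Longrightarrow> r < R \<Longrightarrow> (y has_real_derivative z r) (at r)"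
  shows "(y has_real_derivative z 0) (at 0 within {0..<R})"
proof -
  define S where "S = R / 2"
  have S: "0 < S" "S < R" using assms by (auto simp: S_def)
  have c: "continuous_on {0..S} y" "continuous_on {0..S} z"
    using assms S by (auto intro: continuous_on_subset)
  have y: "y 0 + integral {0..r} z = y r" if r: "r \<in> {0..S}" for r
  proof -
    have "(z has_integral (y r - y 0)) {0..r}"
      by (rule fundamental_theorem_of_calculus_interior)
        (use r c S d in \<open>auto intro: continuous_on_subset simp: has_real_derivative_iff_has_vector_derivative[symmetric]\<close>)
    thus ?thesis by (simp add: integral_unique)
  qed
  have "((\<lambda>r. y 0 + integral {0..r} z) has_real_derivative z 0) (at 0 within {0..S})"
    using DERIV_add[OF DERIV_const integral_has_real_derivative[OF c(2), of 0]] S by auto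
  hence "(y has_real_derivative z 0) (at 0 within {0..S})"
    by (rule has_field_derivative_transform_within[where d = 1]) (use S y in auto)
  moreover have "at 0 within {0..S} = at 0 within {0..<R}"
    by (rule at_within_nhd[of 0 "{..<S}"]) (use S in auto)
  ultimately show ?thesis by simp
qed

text \<open>The function w is the difference quotient of y at 0, completed by \<open>\<mu>\<close>;
  its continuity at 0 is the statement that y has one-sided derivative \<open>\<mu>\<close>
  there.\<close>

lemma profile_imp_sing_sys:
  assumes prof: "profile m k \<mu> R y z" and S: "0 < S" "S < R"
  defines "w \<equiv> (\<lambda>r. if r = 0 then \<mu> else (y r - 1) / r)"
  shows "sing_sys (1 + m / 2) S (\<lambda>r. reduced_rhs m k (y r) (w r) (z r)) w (\<lambda>r. z r - w r)"
proof -
  have c: "continuous_on {0..S} y" "continuous_on {0..S} z"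
    using prof S unfolding profile_def by (auto intro: continuous_on_subset)
  have 0: "y 0 = 1" "z 0 = \<mu>" using prof unfolding profile_def by auto
  have d: "y r > 0" "(y has_real_derivative z r) (at r)"
    "(z has_real_derivative accel m k r (y r) (z r)) (at r)" if "0 < r" "r < R" for r
    using prof that unfolding profile_def by auto
  have "(y has_real_derivative \<mu>) (at 0 within {0..<R})"
    using right_derivative_at_0[of R y z] prof S 0 unfolding profile_def by auto
  hence "((\<lambda>r. (y r - 1) / r) \<longlongrightarrow> \<mu>) (at 0 within {0..<R})"
    by (simp add: has_field_derivative_iff 0)
  hence lim: "((\<lambda>r. (y r - 1) / r) \<longlongrightarrow> \<mu>) (at 0 within {0..S})"
    by (rule tendsto_within_subset) (use S in auto)
  have cw: "continuous_on {0..S} w"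
  proof (rule continuous_on_eq_continuous_within[THEN iffD2], rule ballI)
    fix r assume r: "r \<in> {0..S}"
    show "continuous (at r within {0..S}) w"
    proof (cases "r = 0")
      case True
      have "(w \<longlongrightarrow> \<mu>) (at 0 within {0..S})"
        by (rule Lim_transform_eventually[OF lim]) (auto simp: w_def eventually_at_filter)
      thus ?thesis using True by (simp add: continuous_within w_def)
    next
      case False
      have "\<forall>\<^sub>F x in nhds r. x \<noteq> 0" using False by (rule t1_space_nhds)
      hence ev: "\<forall>\<^sub>F x in at r within {0..S}. (y x - 1) / x = w x"
        unfolding eventually_at_filter by eventually_elim (simp add: w_def)
      have "(y \<longlongrightarrow> y r) (at r within {0..S})"
        using c(1) r unfolding continuous_on by blast
      hence "((\<lambda>x. (y x - 1) / x) \<longlongrightarrow> (y r - 1) / r) (at r within {0..S})"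
        using False by (intro tendsto_intros) auto
      from Lim_transform_eventually[OF this ev] show ?thesis
        using False by (simp add: continuous_within w_def)
    qed
  qed
  show ?thesis unfolding sing_sys_def
  proof (intro conjI ballI cw continuous_on_diff c)
    show "z 0 - w 0 = 0" by (simp add: 0 w_def)
    fix r assume "r \<in> {0<..<S}"
    hence r: "0 < r" "r < R" using S by auto
    have wr: "w r = (y r - 1) / r" using r by (simp add: w_def)
    have ev: "\<forall>\<^sub>F x in nhds r. w x = (y x - 1) / x"
      using t1_space_nhds[of r 0] r by (metis (mono_tags, lifting) eventually_mono less_irrefl w_def)
    have "((\<lambda>x. (y x - 1) / x) has_real_derivative (z r - w r) / r) (at r)"
      using r by (auto intro!: derivative_eq_intros d simp: wr field_simps)
    thus dw: "(w has_real_derivative (z r - w r) / r) (at r)"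
      using DERIV_cong_ev[OF refl ev refl] by blast
    have "y r = 1 + r * w r" using r by (simp add: wr)
    with accel_eq_reduced_rhs[of r "w r" m k "z r"] d(1)[OF r] r
    have a: "accel m k r (y r) (z r) = reduced_rhs m k (y r) (w r) (z r) - m / 2 * (z r - w r) / r"
      by simp
    show "((\<lambda>r. z r - w r) has_real_derivative
        reduced_rhs m k (y r) (w r) (z r) - (1 + m / 2) * (z r - w r) / r) (at r)"
      by (rule derivative_eq_intros d(3)[OF r] dw refl)+
        (use r in \<open>simp add: a field_simps\<close>)
  qed
qed

text \<open>On the compact interval up to a point S between r and R, both solutions have y bounded
  below by some \<open>\<delta>\<close> > 0 and w, z bounded by some M. With these constants the
  clipping is invisible to both, and the Lipschitz bound of the clipped function applies.\<close>

lemma profile_unique: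
  assumes 1: "profile m k \<mu> R y z" and 2: "profile m k \<mu> R u v" and "m > 0" and r: "r \<in> {0..<R}"
  shows "y r = u r" "z r = v r"
proof -
  define S where "S = (r + R) / 2"
  have S: "0 < S" "S < R" "r \<in> {0..S}" using r by (auto simp: S_def)
  define w1 where "w1 = (\<lambda>r. if r = 0 then \<mu> else (y r - 1) / r)"
  define w2 where "w2 = (\<lambda>r. if r = 0 then \<mu> else (u r - 1) / r)"
  have s1: "sing_sys (1 + m / 2) S (\<lambda>r. reduced_rhs m k (y r) (w1 r) (z r)) w1 (\<lambda>r. z r - w1 r)"
    unfolding w1_def by (rule profile_imp_sing_sys[OF 1 S(1,2)])
  have s2: "sing_sys (1 + m / 2) S (\<lambda>r. reduced_rhs m k (u r) (w2 r) (v r)) w2 (\<lambda>r. v r - w2 r)"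
    unfolding w2_def by (rule profile_imp_sing_sys[OF 2 S(1,2)])
  have c: "continuous_on {0..S} y" "continuous_on {0..S} z"
    "continuous_on {0..S} u" "continuous_on {0..S} v"
    using 1 2 S unfolding profile_def by (auto intro: continuous_on_subset)
  have cw: "continuous_on {0..S} w1" "continuous_on {0..S} w2"
    using s1 s2 unfolding sing_sys_def by auto
  have 0: "y 0 = 1" "u 0 = 1" using 1 2 by (auto simp: profile_def)
  have pos: "y s > 0" "u s > 0" if "s \<in> {0..S}" for s
    using that 1 2 S 0 unfolding profile_def by (cases "s = 0"; auto)+
  obtain \<delta> where \<delta>: "\<delta> > 0" "\<And>s. s \<in> {0..S} \<Longrightarrow> \<delta> \<le> min (y s) (u s)"
  proof -
    have "continuous_on {0..S} (\<lambda>s. min (y s) (u s))" by (intro continuous_intros c)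
    from continuous_attains_inf[OF compact_Icc _ this] S
    obtain x where "x \<in> {0..S}" "\<And>s. s \<in> {0..S} \<Longrightarrow> min (y x) (u x) \<le> min (y s) (u s)"
      by auto
    with pos[of x] show thesis by (intro that[of "min (y x) (u x)"]) auto
  qed
  obtain M where M: "\<And>s. s \<in> {0..S} \<Longrightarrow> \<bar>w1 s\<bar> + \<bar>w2 s\<bar> + \<bar>z s\<bar> + \<bar>v s\<bar> \<le> M"
  proof -
    have "continuous_on {0..S} (\<lambda>s. \<bar>w1 s\<bar> + \<bar>w2 s\<bar> + \<bar>z s\<bar> + \<bar>v s\<bar>)"
      by (intro continuous_intros c cw)
    from continuous_attains_sup[OF compact_Icc _ this] S show thesis
      using that by (metis atLeastAtMost_iff empty_iff order_refl less_imp_le)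
  qed
  have "M \<ge> 0" using M[of 0] S by auto
  obtain K where K: "K \<ge> 0" "\<And>r w p v q. r \<in> {0..S} \<Longrightarrow>
    \<bar>clipped_rhs m k \<delta> M r w p - clipped_rhs m k \<delta> M r v q\<bar> \<le> K * (\<bar>w - v\<bar> + \<bar>p - q\<bar>)"
    using clipped_rhs_lipschitz[of \<delta> M S m k] \<delta>(1) \<open>M \<ge> 0\<close> S by auto
  have yw: "y s = 1 + s * w1 s" "u s = 1 + s * w2 s" for s
    using 0 by (auto simp: w1_def w2_def)
  have lip: "\<bar>reduced_rhs m k (y s) (w1 s) (z s) - reduced_rhs m k (u s) (w2 s) (v s)\<bar>
      \<le> K * (\<bar>w1 s - w2 s\<bar> + \<bar>(z s - w1 s) - (v s - w2 s)\<bar>)" if s: "s \<in> {0..S}" for s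
  proof -
    have "reduced_rhs m k (y s) (w1 s) (z s) = clipped_rhs m k \<delta> M s (w1 s) (z s - w1 s)"
      using clipped_rhs_eq[of \<delta> s "w1 s" M "z s - w1 s" m k] \<delta>(2)[OF s] M[OF s] by (simp add: yw)
    moreover have "reduced_rhs m k (u s) (w2 s) (v s) = clipped_rhs m k \<delta> M s (w2 s) (v s - w2 s)"
      using clipped_rhs_eq[of \<delta> s "w2 s" M "v s - w2 s" m k] \<delta>(2)[OF s] M[OF s] by (simp add: yw)
    ultimately show ?thesis using K(2)[OF s] by metis
  qed
  have "w1 0 = w2 0" by (simp add: w1_def w2_def)
  note uni = sing_sys_unique[OF _ S(1) K(1) lip s1 s2 this S(3)]
  have "w1 r = w2 r" "z r - w1 r = v r - w2 r" using uni \<open>m > 0\<close> by auto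
  thus "y r = u r" "z r = v r" by (simp_all add: yw)
qed

lemma sing_sys_accel:
  assumes s: "sing_sys (1 + m / 2) R (\<lambda>r. clipped_rhs m k \<delta> M r (w r) (p r)) w p"
    and r: "0 < r" "r < R" and "\<delta> > 0"
    and "\<delta> \<le> 1 + r * w r" "\<bar>w r\<bar> \<le> M" "\<bar>w r + p r\<bar> \<le> M"
  shows "((\<lambda>r. w r + p r) has_real_derivative accel m k r (1 + r * w r) (w r + p r)) (at r)"
proof -
  have dw: "(w has_real_derivative p r / r) (at r)"
    and dp: "(p has_real_derivative clipped_rhs m k \<delta> M r (w r) (p r) - (1 + m / 2) * p r / r) (at r)"
    using s r unfolding sing_sys_def by auto
  show ?thesis
    by (rule derivative_eq_intros dw dp refl)+
      (use assms in \<open>simp add: clipped_rhs_eq accel_eq_reduced_rhs field_simps\<close>)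
qed

section \<open>A priori bounds\<close>

text \<open>First-exit principle: the set where f \<le> 0 is closed, so if it were nonempty its
  infimum would belong to it, and \<open>step\<close> forbids exactly that.\<close>

lemma continuous_positive_trap:
  fixes f :: "real \<Rightarrow> real"
  assumes "continuous_on {0..R} f" "f 0 > 0"
    and step: "\<And>r. 0 < r \<Longrightarrow> r \<le> R \<Longrightarrow> (\<And>s. 0 \<le> s \<Longrightarrow> s < r \<Longrightarrow> f s > 0) \<Longrightarrow> f r > 0"
    and r: "r \<in> {0..R}"
  shows "f r > 0"
proof (rule ccontr)
  assume "\<not> f r > 0"
  define Z where "Z = {s \<in> {0..R}. f s \<le> 0}"
  have "Z = {0..R} \<inter> f -` {..0}" by (auto simp: Z_def)
  hence "closed Z" using continuous_closed_preimage[OF assms(1)] by simp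
  moreover have "r \<in> Z" using r \<open>\<not> f r > 0\<close> by (auto simp: Z_def)
  moreover have bdd: "bdd_below Z" unfolding Z_def by (rule bdd_belowI[of _ 0]) auto
  ultimately have "Inf Z \<in> Z" using closed_contains_Inf by blast
  hence i: "0 \<le> Inf Z" "Inf Z \<le> R" "f (Inf Z) \<le> 0" by (auto simp: Z_def)
  have "f s > 0" if "0 \<le> s" "s < Inf Z" for s
  proof (rule ccontr)
    assume "\<not> f s > 0"
    hence "s \<in> Z" using that i by (auto simp: Z_def)
    thus False using cInf_lower[OF _ bdd] that by force
  qed
  moreover have "Inf Z \<noteq> 0" using i assms(2) by auto
  ultimately show False using step[of "Inf Z"] i by auto
qed

text \<open>Since (s w)' = z, the value w r is a mean slope of y; bounds and signs of z thereby pass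
  to w.\<close>

lemma secant_slope_mean_value:
  fixes w z :: "real \<Rightarrow> real"
  assumes "0 < r" "continuous_on {0..r} w"
    and d: "\<And>s. 0 < s \<Longrightarrow> s \<le> r \<Longrightarrow> (w has_real_derivative (z s - w s) / s) (at s)"
  obtains \<xi> where "0 < \<xi>" "\<xi> < r" "w r = z \<xi>"
proof -
  have *: "((\<lambda>s. s * w s) has_real_derivative z s) (at s)" if "0 < s" "s < r" for s
    using that by (auto intro!: derivative_eq_intros d simp: field_simps)
  have "continuous_on {0..r} (\<lambda>s. s * w s)" by (intro continuous_intros assms)
  then obtain l \<xi> where \<xi>: "0 < \<xi>" "\<xi> < r" "DERIV (\<lambda>s. s * w s) \<xi> :> l" "r * w r - 0 * w 0 = (r - 0) * l"
    using MVT[of 0 r "\<lambda>s. s * w s"] \<open>0 < r\<close> * by (auto simp: real_differentiable_def)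
  from \<xi> * have "l = z \<xi>" using DERIV_unique by blast
  with \<xi> \<open>0 < r\<close> show thesis by (intro that[of \<xi>]) auto
qed

lemma continuous_limit_le:
  fixes f :: "real \<Rightarrow> real"
  assumes "continuous_on {0..r} f" "0 < r" "\<And>s. 0 < s \<Longrightarrow> s < r \<Longrightarrow> f s \<le> c"
  shows "f r \<le> c"
proof (rule tendsto_upperbound)
  show "(f \<longlongrightarrow> f r) (at_left r)"
    using assms(1,2) continuous_on_Icc_at_leftD by blast
  show "\<forall>\<^sub>F s in at_left r. f s \<le> c"
    using assms eventually_at_left[of 0 r] by auto
qed auto

text \<open>Supplies the exit step for negative slope: the sign of z is known only before r. At r,
  monotonicity of E gives z - A (1 - y) / y \<ge> - N; both summands are nonpositive, so each is at
  least - N, and the second one rearranges to the bound for y.\<close>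

lemma neg_slope_bounds:
  fixes w z :: "real \<Rightarrow> real"
  assumes "m > 0" "k > 0" "0 < r" "k * r < m" "\<mu> < 0" "w 0 = \<mu>" "z 0 = \<mu>"
    and c: "continuous_on {0..r} w" "continuous_on {0..r} z"
    and dw: "\<And>s. 0 < s \<Longrightarrow> s \<le> r \<Longrightarrow> (w has_real_derivative (z s - w s) / s) (at s)"
    and dz: "\<And>s. 0 < s \<Longrightarrow> s \<le> r \<Longrightarrow>
      (z has_real_derivative accel m k s (1 + s * w s) (z s)) (at s)"
    and pos: "\<And>s. 0 < s \<Longrightarrow> s \<le> r \<Longrightarrow> 1 + s * w s > 0"
    and neg: "\<And>s. 0 < s \<Longrightarrow> s < r \<Longrightarrow> z s < 0"
  defines "A \<equiv> (m - k * r) / (2 * r)" and "N \<equiv> - (1 + m / 2) * \<mu>"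
  shows "z r < 0" "z r \<ge> - N" "1 + r * w r \<ge> A / (A + N)"
proof -
  define y where "y s = 1 + s * w s" for s
  have wr: "w r < 0"
    using secant_slope_mean_value[OF \<open>0 < r\<close> c(1) dw] neg by metis
  have ypos: "y s > 0" if "0 \<le> s" "s \<le> r" for s
    using pos[of s] that by (cases "s = 0") (auto simp: y_def)
  have y1: "y r < 1" using wr \<open>0 < r\<close> by (simp add: y_def mult_pos_neg)
  have "z r \<le> 0" using neg by (intro continuous_limit_le[OF c(2) \<open>0 < r\<close>]) force
  \<comment> \<open>If z vanished at r, then y < 1 would make its derivative there negative, so z
    would be positive just before r.\<close>
  moreover have "z r \<noteq> 0"
  proof
    assume "z r = 0"
    have "(y r)\<^sup>2 < 1" using y1 ypos[of r] \<open>0 < r\<close> by (simp add: abs_square_less_1)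
    hence "accel m k r (y r) (z r) < 0"
      using \<open>z r = 0\<close> \<open>m > 0\<close> \<open>0 < r\<close> ypos[of r] unfolding accel_def
      by (auto intro!: divide_neg_pos mult_pos_neg)
    with DERIV_neg_dec_left[OF dz[of r]] obtain d where
      d: "d > 0" "\<And>h. 0 < h \<Longrightarrow> h < d \<Longrightarrow> z r < z (r - h)"
      using \<open>0 < r\<close> by (auto simp: y_def)
    define h where "h = min d r / 2"
    have "0 < h" "h < d" "h < r" using d(1) \<open>0 < r\<close> by (auto simp: h_def)
    thus False using d(2)[of h] neg[of "r - h"] \<open>z r = 0\<close> by simp
  qed
  ultimately show zr: "z r < 0" by simp
  \<comment> \<open>The term of the acceleration that contains z is - A z / y^2, which is minus the
    derivative of 1 - 1/y times A; adding A (1 - 1/y) to z therefore absorbs it. Writing w for (y -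
    1) / s removes the pole of A, so E is continuous at 0.\<close>
  define E where "E s = z s + (m - k * s) / 2 * w s / y s" for s
  have cy: "continuous_on {0..r} y" unfolding y_def by (intro continuous_intros c)
  have dy: "(y has_real_derivative z s) (at s)" if "0 < s" "s \<le> r" for s
    unfolding y_def using that by (auto intro!: derivative_eq_intros dw simp: field_simps)
  have "E 0 \<le> E r"
  proof (rule DERIV_nonneg_imp_increasing_open[of 0 r E])
    show "continuous_on {0..r} E"
      proof -
      have "\<forall>s\<in>{0..r}. y s \<noteq> 0" using ypos by (metis atLeastAtMost_iff less_irrefl)
      thus ?thesis unfolding E_def by (intro continuous_intros c cy) auto
    qed
    fix s assume s: "0 < s" "s < r"
    have "y s > 0" using ypos s by simp
    have ws: "w s = (y s - 1) / s" using s by (simp add: y_def)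
    have "(E has_real_derivative accel m k s (y s) (z s) +
        ((- k / 2 * w s + (m - k * s) / 2 * ((z s - w s) / s)) * y s
          - (m - k * s) / 2 * w s * z s) / (y s * y s)) (at s)"
      unfolding E_def
      using dz[of s] s \<open>y s > 0\<close> unfolding y_def[symmetric]
      by (auto intro!: derivative_eq_intros dw dy simp: field_simps)
    moreover have "accel m k s (y s) (z s) +
        ((- k / 2 * w s + (m - k * s) / 2 * ((z s - w s) / s)) * y s
          - (m - k * s) / 2 * w s * z s) / (y s * y s) = m * (w s)\<^sup>2 / (4 * y s)"
      unfolding accel_def ws using s \<open>y s > 0\<close>
      by (simp add: field_simps power2_eq_square)
    moreover have "m * (w s)\<^sup>2 / (4 * y s) \<ge> 0" using \<open>m > 0\<close> \<open>y s > 0\<close> by simp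
    ultimately show "\<exists>D. (E has_real_derivative D) (at s) \<and> D \<ge> 0" by metis
  qed (use \<open>0 < r\<close> in auto)
  moreover have "E 0 = - N" by (simp add: E_def N_def y_def assms algebra_simps)
  ultimately have E: "- N \<le> z r + (m - k * r) / 2 * w r / y r" by (simp add: E_def)
  have "(m - k * r) / 2 * w r / y r \<le> 0"
    using wr assms(4) ypos[of r] \<open>0 < r\<close> by (intro divide_nonpos_pos mult_nonneg_nonpos) auto
  with E show "z r \<ge> - N" by simp
  have "A > 0" using assms(1-4) by (simp add: A_def)
  have "N > 0" unfolding N_def using assms(1,5) by (intro mult_neg_neg) auto
  have "(m - k * r) / 2 * w r / y r = A * (y r - 1) / y r"
    using \<open>0 < r\<close> by (simp add: A_def y_def)
  with E zr have "- N \<le> A * (y r - 1) / y r" by simp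
  hence "- N * y r \<le> A * (y r - 1)" using ypos[of r] \<open>0 < r\<close> by (simp add: pos_le_divide_eq)
  hence "A \<le> y r * (A + N)" by (simp add: algebra_simps)
  thus "1 + r * w r \<ge> A / (A + N)"
    using \<open>A > 0\<close> \<open>N > 0\<close> by (simp add: y_def pos_divide_le_eq)
qed

text \<open>
  At a first contact of z with the barrier, w \<le> z, so the singular term has the good sign; the
  quadratic term is at most (3 m / 4) z (w / y), and w / y \<le> min w (1 / r) is bounded by
  1 / \<epsilon> both before and after r = \<epsilon>.
\<close>

lemma pos_slope_bounds:
  fixes w z :: "real \<Rightarrow> real"
  assumes "m > 0" "k > 0" "0 < r" "\<mu> > 0" "w 0 = \<mu>" "z 0 = \<mu>"
    and c: "continuous_on {0..r} w" "continuous_on {0..r} z"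
    and dw: "\<And>s. 0 < s \<Longrightarrow> s \<le> r \<Longrightarrow> (w has_real_derivative (z s - w s) / s) (at s)"
    and dz: "\<And>s. 0 < s \<Longrightarrow> s \<le> r \<Longrightarrow>
      (z has_real_derivative accel m k s (1 + s * w s) (z s)) (at s)"
    and \<epsilon>: "\<epsilon> > 0" "\<beta> > 0" "\<beta> * exp ((m / \<epsilon> + k) * \<epsilon>) \<le> 1 / \<epsilon>"
    and bnd: "\<And>s. 0 < s \<Longrightarrow> s < r \<Longrightarrow> 0 < z s \<and> z s < \<beta> * exp ((m / \<epsilon> + k) * s)"
  shows "0 < z r" "z r < \<beta> * exp ((m / \<epsilon> + k) * r)"
proof -
  define q where "q = m / \<epsilon> + k"
  define b where "b s = \<beta> * exp (q * s)" for s
  have "q > 0" using assms by (simp add: q_def add_pos_pos)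
  have bpos: "b s > 0" for s using \<epsilon> by (simp add: b_def)
  have bmono: "b s \<le> b t" if "s \<le> t" for s t
    using that \<open>q > 0\<close> \<epsilon> by (simp add: b_def)
  define y where "y s = 1 + s * w s" for s
  obtain \<xi> where \<xi>: "0 < \<xi>" "\<xi> < r" "w r = z \<xi>"
    using secant_slope_mean_value[OF \<open>0 < r\<close> c(1) dw] by metis
  have wr: "0 < w r" "w r \<le> b r"
    using bnd[OF \<xi>(1,2)] bmono[of \<xi> r] \<xi> by (auto simp: b_def q_def)
  hence y1: "y r > 1" using \<open>0 < r\<close> by (simp add: y_def)
  have "- z r \<le> 0" using bnd
    by (intro continuous_limit_le[OF continuous_on_minus[OF c(2)] \<open>0 < r\<close>]) force
  hence z0: "z r \<ge> 0" by simp
  have zb: "z r \<le> b r"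
  proof -
    have "continuous_on {0..r} (\<lambda>s. z s - b s)"
      unfolding b_def by (intro continuous_intros c)
    from continuous_limit_le[OF this \<open>0 < r\<close>, of 0] bnd
    show ?thesis by (force simp: b_def q_def)
  qed
  note dzr = dz[OF \<open>0 < r\<close> order_refl]
  have "z r \<noteq> 0"
  proof
    assume "z r = 0"
    have "(y r)\<^sup>2 > 1" using y1 by (simp add: power2_eq_square less_1_mult)
    hence "accel m k r (y r) (z r) > 0"
      using \<open>z r = 0\<close> \<open>m > 0\<close> \<open>0 < r\<close> y1 unfolding accel_def by auto
    with DERIV_pos_inc_left[OF dzr] obtain d where
      d: "d > 0" "\<And>h. 0 < h \<Longrightarrow> h < d \<Longrightarrow> z r > z (r - h)" by (auto simp: y_def)
    define h where "h = min d r / 2"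
    have "0 < h" "h < d" "h < r" using d(1) \<open>0 < r\<close> by (auto simp: h_def)
    thus False using d(2)[of h] bnd[of "r - h"] \<open>z r = 0\<close> by simp
  qed
  with z0 show "0 < z r" by simp
  have "z r \<noteq> b r"
  proof
    assume eq: "z r = b r"
    define X Y where "X = m / \<epsilon> * b r" and "Y = k * b r"
    have wy: "w r / y r \<le> 1 / \<epsilon>"
    proof (cases "r \<le> \<epsilon>")
      case True
      have "w r / y r \<le> w r" using wr y1 by (simp add: divide_le_eq)
      also have "\<dots> \<le> b \<epsilon>" using wr bmono[OF True] by simp
      also have "\<dots> \<le> 1 / \<epsilon>" using \<epsilon> by (simp add: b_def q_def)
      finally show ?thesis .
    next
      case False
      have "w r / y r \<le> 1 / r" using y1 \<open>0 < r\<close>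
        by (intro mult_imp_div_pos_le) (auto simp: y_def field_simps)
      also have "\<dots> \<le> 1 / \<epsilon>" using False \<epsilon> by (simp add: frac_le)
      finally show ?thesis .
    qed
    have "accel m k r (y r) (z r) = m / (2 * r * (y r)\<^sup>2) * (w r - b r)
        + m / 4 * (w r)\<^sup>2 * (y r + 2) / (y r)\<^sup>2 + k * b r / (2 * (y r)\<^sup>2)"
      using accel_expand[of r "w r" m k "z r"] y1 \<open>0 < r\<close> eq by (simp add: y_def)
    moreover have "m / (2 * r * (y r)\<^sup>2) * (w r - b r) \<le> 0"
      using wr y1 \<open>m > 0\<close> \<open>0 < r\<close> by (intro mult_nonneg_nonpos) auto
    moreover have "m / 4 * (w r)\<^sup>2 * (y r + 2) / (y r)\<^sup>2 \<le> 3 / 4 * X"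
    proof -
      have "m / 4 * (w r)\<^sup>2 * (y r + 2) / (y r)\<^sup>2 = m / 4 * w r * (w r / y r) * ((y r + 2) / y r)"
        by (simp add: power2_eq_square)
      also have "\<dots> \<le> m / 4 * b r * (1 / \<epsilon>) * 3"
        using wr y1 wy \<open>m > 0\<close> bpos[of r] \<epsilon>
        by (intro mult_mono) (auto simp: divide_le_eq)
      finally show ?thesis by (simp add: X_def mult_ac)
    qed
    moreover have "k * b r / (2 * (y r)\<^sup>2) \<le> Y / 2"
    proof -
      have "k * b r / (2 * (y r)\<^sup>2) \<le> k * b r / (2 * 1)"
        using y1 \<open>k > 0\<close> bpos[of r] by (intro divide_left_mono) (auto simp: one_le_power)
      thus ?thesis by (simp add: Y_def)
    qed
    \<comment> \<open>The rate q is chosen for this identity: the acceleration is at most 3/4 X +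
      Y/2, strictly below X + Y. Hence b - z has positive derivative at the contact and would be
      negative just before it.\<close>
    moreover have "q * b r = X + Y" by (simp add: q_def X_def Y_def algebra_simps)
    moreover have "X > 0" "Y > 0"
      using \<open>m > 0\<close> \<open>k > 0\<close> \<epsilon> bpos[of r] by (simp_all add: X_def Y_def)
    ultimately have lt: "accel m k r (y r) (z r) < q * b r" by linarith
    have "((\<lambda>s. b s - z s) has_real_derivative q * b r - accel m k r (y r) (z r)) (at r)"
      unfolding b_def using dzr unfolding y_def[symmetric]
      by (auto intro!: derivative_eq_intros)
    from DERIV_pos_inc_left[OF this] lt obtain d where
      d: "d > 0" "\<And>h. 0 < h \<Longrightarrow> h < d \<Longrightarrow> b (r - h) - z (r - h) < b r - z r" by auto
    define h where "h = min d r / 2"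
    have "0 < h" "h < d" "h < r" using d(1) \<open>0 < r\<close> by (auto simp: h_def)
    thus False using d(2)[of h] bnd[of "r - h"] eq by (simp add: b_def q_def)
  qed
  with zb show "z r < \<beta> * exp ((m / \<epsilon> + k) * r)" by (simp add: b_def q_def)
qed

text \<open>The region of confinement is encoded as positivity of one scalar f, so that the
  first-exit principle applies. The condition \<open>box\<close> asks only f \<ge> 0, because this
  is all that is known at a possible exit point; it already makes the clipping inactive there, and
  \<open>step\<close> improves it to f > 0.\<close>

lemma profile_exists_if_confined:
  fixes f :: "real \<Rightarrow> real \<Rightarrow> real \<Rightarrow> real"
  assumes "m > 0" "0 < \<delta>" "0 \<le> M" "0 < R" "R < S"
    and cont: "\<And>w z. continuous_on {0..R} w \<Longrightarrow> continuous_on {0..R} z \<Longrightarrow>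
      continuous_on {0..R} (\<lambda>s. f s (1 + s * w s) (z s))"
    and init: "f 0 1 \<mu> > 0"
    and box: "\<And>s y z. 0 \<le> s \<Longrightarrow> s \<le> R \<Longrightarrow> f s y z \<ge> 0 \<Longrightarrow> \<delta> \<le> y \<and> \<bar>z\<bar> \<le> M"
    and step: "\<And>w z r. 0 < r \<Longrightarrow> r \<le> R \<Longrightarrow> w 0 = \<mu> \<Longrightarrow> z 0 = \<mu> \<Longrightarrow>
      continuous_on {0..r} w \<Longrightarrow> continuous_on {0..r} z \<Longrightarrow>
      (\<And>s. 0 < s \<Longrightarrow> s \<le> r \<Longrightarrow> (w has_real_derivative (z s - w s) / s) (at s)) \<Longrightarrow>
      (\<And>s. 0 < s \<Longrightarrow> s \<le> r \<Longrightarrow>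
        (z has_real_derivative accel m k s (1 + s * w s) (z s)) (at s)) \<Longrightarrow>
      (\<And>s. 0 < s \<Longrightarrow> s \<le> r \<Longrightarrow> 1 + s * w s > 0) \<Longrightarrow>
      (\<And>s. 0 < s \<Longrightarrow> s < r \<Longrightarrow> f s (1 + s * w s) (z s) > 0) \<Longrightarrow>
      f r (1 + r * w r) (z r) > 0"
  shows "\<exists>y z. profile m k \<mu> R y z"
proof -
  \<comment> \<open>The clipped system is solved up to S > R so that its differential equations,
    stated on an open interval, also hold at R.\<close>
  obtain w p where sys: "sing_sys (1 + m / 2) S (\<lambda>r. clipped_rhs m k \<delta> M r (w r) (p r)) w p"
    and w0: "w 0 = \<mu>"
    using clipped_rhs_solution_exists[of \<delta> M S "1 + m / 2" m k \<mu>] assms(1-5) by auto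
  define z where "z s = w s + p s" for s
  have z0: "z 0 = \<mu>" using sys w0 by (simp add: z_def sing_sys_def)
  have c: "continuous_on {0..R} w" "continuous_on {0..R} z"
    using sys \<open>R < S\<close> unfolding sing_sys_def z_def
    by (auto intro!: continuous_on_add intro: continuous_on_subset)
  have dw: "(w has_real_derivative (z s - w s) / s) (at s)" if "0 < s" "s \<le> R" for s
    using sys that \<open>R < S\<close> unfolding sing_sys_def z_def by auto
  have cf: "continuous_on {0..R} (\<lambda>s. f s (1 + s * w s) (z s))" by (rule cont[OF c])
  have in_box: "\<delta> \<le> 1 + s * w s \<and> \<bar>z s\<bar> \<le> M \<and> \<bar>w s\<bar> \<le> M"
    if "r \<le> R" "0 \<le> s" "s \<le> r" and nn: "\<And>t. 0 \<le> t \<Longrightarrow> t \<le> r \<Longrightarrow> f t (1 + t * w t) (z t) \<ge> 0"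
    for r s
  proof -
    \<comment> \<open>The box bounds z only; w inherits the bound M because each of its values is a
      value of z.\<close>
    have zM: "\<bar>z t\<bar> \<le> M" if "0 \<le> t" "t \<le> s" for t
      using box[OF _ _ nn[of t]] that \<open>s \<le> r\<close> \<open>r \<le> R\<close> by auto
    have "\<bar>w s\<bar> \<le> M"
    proof (cases "s = 0")
      case True
      then show ?thesis using zM[of 0] w0 z0 \<open>0 \<le> s\<close> by simp
    next
      case False
      hence s: "0 < s" "s \<le> R" using that by auto
      hence cs: "continuous_on {0..s} w" using c(1) by (auto intro: continuous_on_subset)
      have "(w has_real_derivative (z t - w t) / t) (at t)" if "0 < t" "t \<le> s" for t
        using dw[of t] that s by simp
      from secant_slope_mean_value[OF s(1) cs this]
      obtain \<xi> where "0 < \<xi>" "\<xi> < s" "w s = z \<xi>" .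
      with zM[of \<xi>] show ?thesis by simp
    qed
    with box[OF _ _ nn[of s]] that show ?thesis by auto
  qed
  have dz: "(z has_real_derivative accel m k s (1 + s * w s) (z s)) (at s)"
    if "r \<le> R" "0 < s" "s \<le> r" "\<And>t. 0 \<le> t \<Longrightarrow> t \<le> r \<Longrightarrow> f t (1 + t * w t) (z t) \<ge> 0" for r s
    using sing_sys_accel[OF sys, of s] in_box[of r s] that \<open>0 < \<delta>\<close> \<open>R < S\<close> unfolding z_def by auto
  have pos: "f r (1 + r * w r) (z r) > 0" if "r \<in> {0..R}" for r
  proof (rule continuous_positive_trap[OF cf])
    show "f 0 (1 + 0 * w 0) (z 0) > 0" using init z0 by simp
    fix r assume r: "0 < r" "r \<le> R" and prev: "\<And>s. 0 \<le> s \<Longrightarrow> s < r \<Longrightarrow> f s (1 + s * w s) (z s) > 0"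
    have cr: "continuous_on {0..r} w" "continuous_on {0..r} z"
      "continuous_on {0..r} (\<lambda>s. - f s (1 + s * w s) (z s))"
      using c cf r by (auto intro: continuous_on_subset continuous_on_minus)
    \<comment> \<open>Passing to the limit from the left gives f \<ge> 0 at r too, so the unclipped
      equation holds up to and including r, as \<open>step\<close> demands.\<close>
    have "- f r (1 + r * w r) (z r) \<le> 0"
      using prev by (intro continuous_limit_le[OF cr(3) r(1)]) (simp add: less_imp_le)
    hence nn: "f t (1 + t * w t) (z t) \<ge> 0" if "0 \<le> t" "t \<le> r" for t
      using prev[of t] that by (cases "t = r") auto
    show "f r (1 + r * w r) (z r) > 0"
    proof (rule step[OF r w0 z0 cr(1,2)])
      fix s assume s: "0 < s" "s \<le> r"
      show "(w has_real_derivative (z s - w s) / s) (at s)" using dw s r by simp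
      show "(z has_real_derivative accel m k s (1 + s * w s) (z s)) (at s)"
        using dz[OF r(2) s nn] .
      show "1 + s * w s > 0" using in_box[of r s] s r nn \<open>0 < \<delta>\<close> by force
    qed (use prev in auto)
  qed (use that in auto)
  have nn: "f t (1 + t * w t) (z t) \<ge> 0" if "0 \<le> t" "t \<le> R" for t
    using pos[of t] that by simp
  have "profile m k \<mu> R (\<lambda>s. 1 + s * w s) z"
    unfolding profile_def
  proof (intro conjI ballI)
    fix s assume "s \<in> {0<..<R}"
    hence s: "0 < s" "s \<le> R" by auto
    show "((\<lambda>s. 1 + s * w s) has_real_derivative z s) (at s)"
      using s by (auto intro!: derivative_eq_intros dw simp: field_simps)
    show "1 + s * w s > 0" using in_box[of R s] s nn \<open>0 < \<delta>\<close> by force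
    show "(z has_real_derivative accel m k s (1 + s * w s) (z s)) (at s)"
      using dz[of R s] s nn by simp
  qed (use z0 c in \<open>auto intro!: continuous_intros intro: continuous_on_subset\<close>)
  thus ?thesis by blast
qed

section \<open>Existence\<close>

lemma profile_exists_neg:
  assumes "m > 0" "k > 0" "0 < R" "k * R < m" "\<mu> < 0"
  shows "\<exists>y z. profile m k \<mu> R y z"
proof -
  define A where "A s = (m - k * s) / (2 * s)" for s
  define N where "N = - (1 + m / 2) * \<mu>"
  \<comment> \<open>As A decreases, q is the smallest of the lower bounds for y on (0, R]. Using q /
    2 and N + 1 in place of q and N turns the weak inequalities of the a priori bounds into strict
    ones.\<close>
  define q where "q = A R / (A R + N)"
  define \<delta> where "\<delta> = q / 2"
  have "A R > 0" using assms by (simp add: A_def)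
  have "N > 0" unfolding N_def using assms by (intro mult_neg_neg) auto
  have "0 < q" "q < 1" using \<open>A R > 0\<close> \<open>N > 0\<close> by (simp_all add: q_def)
  hence \<delta>: "0 < \<delta>" "\<delta> < 1" "\<delta> < q" by (simp_all add: \<delta>_def)
  have N\<mu>: "- \<mu> \<le> N"
    using mult_nonneg_nonpos[of m \<mu>] assms by (simp add: N_def algebra_simps)
  show ?thesis
  proof (rule profile_exists_if_confined[where \<delta> = \<delta> and M = "N + 1" and S = "R + 1"
        and f = "\<lambda>s y z. min (- z) (min (z + (N + 1)) (y - \<delta>))"])
    fix w z :: "real \<Rightarrow> real" and r
    assume r: "0 < r" "r \<le> R" and h: "w 0 = \<mu>" "z 0 = \<mu>"
      "continuous_on {0..r} w" "continuous_on {0..r} z"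
      "\<And>s. 0 < s \<Longrightarrow> s \<le> r \<Longrightarrow> (w has_real_derivative (z s - w s) / s) (at s)"
      "\<And>s. 0 < s \<Longrightarrow> s \<le> r \<Longrightarrow>
        (z has_real_derivative accel m k s (1 + s * w s) (z s)) (at s)"
      "\<And>s. 0 < s \<Longrightarrow> s \<le> r \<Longrightarrow> 1 + s * w s > 0"
      and f: "\<And>s. 0 < s \<Longrightarrow> s < r \<Longrightarrow>
        min (- z s) (min (z s + (N + 1)) (1 + s * w s - \<delta>)) > 0"
    have "k * r \<le> k * R" using r assms by simp
    hence kr: "k * r < m" using assms by linarith
    have neg: "z s < 0" if "0 < s" "s < r" for s using f[OF that] by simp
    note bnd = neg_slope_bounds[OF assms(1,2) r(1) kr assms(5) h neg,
        folded A_def N_def]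
    have "A R \<le> A r"
      using r assms \<open>k * r \<le> k * R\<close> kr unfolding A_def by (intro frac_le) auto
    hence "q \<le> A r / (A r + N)"
      using \<open>A R > 0\<close> \<open>N > 0\<close> by (simp add: q_def field_simps)
    with bnd \<delta> show "min (- z r) (min (z r + (N + 1)) (1 + r * w r - \<delta>)) > 0"
      by auto
  qed (use assms \<delta> N\<mu> \<open>N > 0\<close> in \<open>auto intro!: continuous_intros\<close>)
qed

lemma profile_exists_pos:
  assumes "m > 0" "k > 0" "0 < R" "\<mu> > 0"
  shows "\<exists>y z. profile m k \<mu> R y z"
proof -
  \<comment> \<open>With \<epsilon> \<le> 1 the exponent of the barrier at s = \<epsilon> is m + k
    \<epsilon> \<le> m + k, so the second entry of the minimum makes the barrier there at most 1 /
    \<epsilon>. The factor 2 starts the barrier strictly above \<open>\<mu>\<close>.\<close>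
  define \<epsilon> where "\<epsilon> = min 1 (1 / (2 * \<mu> * exp (m + k)))"
  have \<epsilon>: "0 < \<epsilon>" "\<epsilon> \<le> 1" using assms by (auto simp: \<epsilon>_def)
  define b where "b s = 2 * \<mu> * exp ((m / \<epsilon> + k) * s)" for s
  have "(m / \<epsilon> + k) * \<epsilon> \<le> m + k" using \<epsilon> assms by (simp add: distrib_right mult_left_le)
  hence "2 * \<mu> * exp ((m / \<epsilon> + k) * \<epsilon>) \<le> 2 * \<mu> * exp (m + k)" using assms by simp
  also have "\<dots> \<le> 1 / \<epsilon>"
  proof -
    have "\<epsilon> * (2 * \<mu> * exp (m + k)) \<le> 1 / (2 * \<mu> * exp (m + k)) * (2 * \<mu> * exp (m + k))"
      using assms unfolding \<epsilon>_def by (intro mult_right_mono) auto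
    thus ?thesis using \<epsilon> assms by (simp add: pos_le_divide_eq mult.commute)
  qed
  finally have \<epsilon>b: "2 * \<mu> * exp ((m / \<epsilon> + k) * \<epsilon>) \<le> 1 / \<epsilon>" .
  have bmono: "b s \<le> b t" if "s \<le> t" for s t
    using that assms \<epsilon> by (simp add: b_def mult_left_mono)
  have b0: "b 0 = 2 * \<mu>" by (simp add: b_def)
  show ?thesis
  proof (rule profile_exists_if_confined[where \<delta> = "1 / 2" and M = "b R" and S = "R + 1"
        and f = "\<lambda>s y z. min z (min (b s - z) (y - 1 / 2))"])
    fix w z :: "real \<Rightarrow> real" and r
    assume r: "0 < r" "r \<le> R" and h: "w 0 = \<mu>" "z 0 = \<mu>"
      "continuous_on {0..r} w" "continuous_on {0..r} z"
      "\<And>s. 0 < s \<Longrightarrow> s \<le> r \<Longrightarrow> (w has_real_derivative (z s - w s) / s) (at s)"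
      "\<And>s. 0 < s \<Longrightarrow> s \<le> r \<Longrightarrow>
        (z has_real_derivative accel m k s (1 + s * w s) (z s)) (at s)"
      and f: "\<And>s. 0 < s \<Longrightarrow> s < r \<Longrightarrow>
        min (z s) (min (b s - z s) (1 + s * w s - 1 / 2)) > 0"
    have zb: "0 < z s \<and> z s < 2 * \<mu> * exp ((m / \<epsilon> + k) * s)" if "0 < s" "s < r" for s
      using f[OF that] by (simp add: b_def)
    have "w r > 0" using secant_slope_mean_value[OF r(1) h(3) h(5)] zb by metis
    hence "r * w r > 0" using r by simp
    moreover have "0 < z r" "z r < b r"
      using pos_slope_bounds[OF assms(1,2) r(1) assms(4) h \<epsilon>(1) _ \<epsilon>b zb] assms
      by (auto simp: b_def)
    ultimately show "min (z r) (min (b r - z r) (1 + r * w r - 1 / 2)) > 0"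
      by auto
  next
    fix s y z :: real
    assume "0 \<le> s" "s \<le> R" "min z (min (b s - z) (y - 1 / 2)) \<ge> 0"
    with bmono[of s R] show "1 / 2 \<le> y \<and> \<bar>z\<bar> \<le> b R" by auto
  next
    show "0 \<le> b R" using assms by (simp add: b_def)
    show "continuous_on {0..R} (\<lambda>s. min (z s) (min (b s - z s) (1 + s * w s - 1 / 2)))"
      if "continuous_on {0..R} w" "continuous_on {0..R} z" for w z :: "real \<Rightarrow> real"
      unfolding b_def using that by (auto intro!: continuous_intros)
  qed (use assms b0 in auto)
qed

lemma profile_exists:
  assumes "m > 0" "k > 0" "0 < R" "k * R < m"
  shows "\<exists>y z. profile m k \<mu> R y z"
proof -
  consider "\<mu> < 0" | "\<mu> = 0" | "\<mu> > 0" by linarith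
  then show ?thesis
  proof cases
    case 2
    have "profile m k \<mu> R (\<lambda>_. 1) (\<lambda>_. 0)"
      using 2 by (auto simp: profile_def accel_def)
    then show ?thesis by blast
  qed (use profile_exists_neg profile_exists_pos assms in blast)+
qed

section \<open>Gluing the solutions on shorter intervals\<close>

lemma profile_glue:
  assumes "m > 0" and ex: "\<And>R. 0 < R \<Longrightarrow> R < L \<Longrightarrow> \<exists>y z. profile m k \<mu> R y z"
    and "L > 0"
  shows "\<exists>y z. profile m k \<mu> L y z"
proof -
  obtain Y Z where YZ: "\<And>R. 0 < R \<Longrightarrow> R < L \<Longrightarrow> profile m k \<mu> R (Y R) (Z R)"
    using ex by metis
  \<comment> \<open>The midpoint of r and L lies beyond r and below L, so the solution it selects is
    defined around r.\<close>
  define y where "y r = Y ((r + L) / 2) r" for r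
  define z where "z r = Z ((r + L) / 2) r" for r
  have eq: "y s = Y R s" "z s = Z R s" if "0 \<le> s" "s < R" "R < L" for s R
  proof -
    define T where "T = (s + L) / 2"
    have "0 < T" "T < L" using that by (auto simp: T_def)
    hence "profile m k \<mu> (min R T) (Y T) (Z T)" "profile m k \<mu> (min R T) (Y R) (Z R)"
      using profile_mono[OF YZ[of T], of "min R T"] profile_mono[OF YZ[of R], of "min R T"] that
      by simp_all
    from profile_unique[OF this \<open>m > 0\<close>, of s] that
    show "y s = Y R s" "z s = Z R s" by (auto simp: y_def z_def T_def)
  qed
  have "profile m k \<mu> L y z"
    unfolding profile_def
  proof (intro conjI ballI)
    have "profile m k \<mu> (L / 2) (Y (L / 2)) (Z (L / 2))" using YZ[of "L / 2"] \<open>L > 0\<close> by simp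
    thus "y 0 = 1" "z 0 = \<mu>" by (auto simp: y_def z_def profile_def)
    have "continuous (at s within {0..<L}) y \<and> continuous (at s within {0..<L}) z"
      if s: "s \<in> {0..<L}" for s
    proof -
      define R where "R = (s + L) / 2"
      have R: "0 < R" "s < R" "R < L" using s by (auto simp: R_def)
      have "continuous_on {0..<R} (Y R)" "continuous_on {0..<R} (Z R)"
        using YZ[OF R(1,3)] by (auto simp: profile_def)
      moreover have "continuous_on {0..<R} y \<longleftrightarrow> continuous_on {0..<R} (Y R)"
        "continuous_on {0..<R} z \<longleftrightarrow> continuous_on {0..<R} (Z R)"
        using eq[of _ R] R by (intro continuous_on_cong; simp)+
      ultimately have "continuous (at s within {0..<R}) y" "continuous (at s within {0..<R}) z"
        using R s by (auto simp: continuous_on_eq_continuous_within)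
      moreover have "at s within {0..<R} = at s within {0..<L}"
        by (rule at_within_nhd[of s "{..<R}"]) (use R in auto)
      ultimately show ?thesis by simp
    qed
    thus "continuous_on {0..<L} y" "continuous_on {0..<L} z"
      by (auto simp: continuous_on_eq_continuous_within)
    fix s assume "s \<in> {0<..<L}"
    hence s: "0 < s" "s < L" by auto
    define R where "R = (s + L) / 2"
    have R: "0 < R" "s < R" "R < L" using s by (auto simp: R_def)
    have d: "Y R s > 0" "(Y R has_real_derivative Z R s) (at s)"
      "(Z R has_real_derivative accel m k s (Y R s) (Z R s)) (at s)"
      using YZ[OF R(1,3)] s R unfolding profile_def by auto
    show "y s > 0" using d(1) eq[of s R] s R by simp
    show "(y has_real_derivative z s) (at s)"
      by (rule has_field_derivative_transform_within_open[of "Y R" _ _ "{0<..<R}"])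
        (use d(2) eq[of _ R] s R in auto)
    show "(z has_real_derivative accel m k s (y s) (z s)) (at s)"
      by (rule has_field_derivative_transform_within_open[of "Z R" _ _ "{0<..<R}"])
        (use d(3) eq[of _ R] s R in auto)
  qed
  thus ?thesis by blast
qed

lemma profile_exists_max:
  assumes "m > 0" "k > 0"
  shows "\<exists>y z. profile m k \<mu> (m / k) y z"
proof (rule profile_glue[OF assms(1)])
  show "\<exists>y z. profile m k \<mu> R y z" if "0 < R" "R < m / k" for R
    using that assms by (intro profile_exists) (auto simp: field_simps)
qed (use assms in simp)

section \<open>Back to the original equation\<close>

lemma is_solution_square:
  assumes prof: "profile (of_int n - 1) (- lam) (mu1 / 2) L y z" and "L > 0"
  shows "is_solution lam mu1 n L (\<lambda>r. (y r)\<^sup>2)"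
proof -
  define m where "m = real_of_int n - 1"
  have c: "continuous_on {0..<L} y" "continuous_on {0..<L} z" and 0: "y 0 = 1" "z 0 = mu1 / 2"
    using prof by (auto simp: profile_def)
  have d: "y r > 0" "(y has_real_derivative z r) (at r)"
    "(z has_real_derivative accel m (- lam) r (y r) (z r)) (at r)" if "r \<in> {0<..<L}" for r
    using prof that unfolding profile_def m_def by auto
  have c': "continuous_on {0<..<L} y" "continuous_on {0<..<L} z"
    using c by (auto intro: continuous_on_subset)
  define h where "h r = (y r)\<^sup>2" for r
  define h1 where "h1 r = 2 * y r * z r" for r
  define h2 where "h2 r = 2 * (z r * z r + y r * accel m (- lam) r (y r) (z r))" for r
  have dh: "(h has_real_derivative h1 r) (at r)" "(h1 has_real_derivative h2 r) (at r)"
    if "r \<in> {0<..<L}" for r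
    unfolding h_def h1_def h2_def
    by (auto intro!: derivative_eq_intros d[OF that] simp: algebra_simps)
  have ch: "continuous_on {0..<L} h" "continuous_on {0..<L} h1" "continuous_on {0<..<L} h2"
  proof -
    show "continuous_on {0..<L} h" "continuous_on {0..<L} h1"
      unfolding h_def h1_def by (intro continuous_intros c)+
    have "\<forall>r\<in>{0<..<L}. y r \<noteq> 0" using d(1) by force
    thus "continuous_on {0<..<L} h2"
      unfolding h2_def accel_def by (intro continuous_intros c') auto
  qed
  have dh0: "(h has_real_derivative mu1) (at 0 within {0..<L})"
    using right_derivative_at_0[OF \<open>L > 0\<close> ch(1,2) dh(1)] by (simp add: h1_def 0)
  have "Ck_on 2 {0<..<L} h"
    unfolding numeral_2_eq_2 Ck_on.simps
    using dh ch(3) by (intro exI[of _ h1] exI[of _ h2]) (blast intro: has_field_derivative_at_within)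
  moreover have "Ck_on 1 {0..<L} h"
    unfolding One_nat_def Ck_on.simps
  proof (intro exI[of _ h1] conjI ballI ch(2))
    fix r assume "r \<in> {0..<L}"
    then consider "r = 0" | "r \<in> {0<..<L}" by force
    thus "(h has_real_derivative h1 r) (at r within {0..<L})"
      by cases (use dh0 dh(1) in \<open>auto simp: h1_def 0 intro: has_field_derivative_at_within\<close>)
  qed
  moreover have "2 * r\<^sup>2 * h r * deriv (deriv h) r =
      m * h r * (h r - 1) + r * deriv h r * (r * deriv h r - lam * r - m) \<and> h r > 0"
    if r: "r \<in> {0<..<L}" for r
  proof -
    have 1: "deriv h s = h1 s" if "s \<in> {0<..<L}" for s
      by (rule DERIV_imp_deriv[OF dh(1)[OF that]])
    have "(deriv h has_real_derivative h2 r) (at r)"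
      by (rule has_field_derivative_transform_within_open[OF dh(2)[OF r], of "{0<..<L}"])
        (use 1 r in auto)
    hence 2: "deriv (deriv h) r = h2 r" by (rule DERIV_imp_deriv)
    have "2 * r\<^sup>2 * (y r)\<^sup>2 * (2 * (z r * z r + y r * accel m (- lam) r (y r) (z r))) =
      m * (y r)\<^sup>2 * ((y r)\<^sup>2 - 1) + r * (2 * y r * z r) * (r * (2 * y r * z r) - lam * r - m)"
      using r d(1)[OF r] unfolding accel_def by (simp add: field_simps power2_eq_square)
    thus ?thesis unfolding 1[OF r] 2 unfolding h_def h1_def h2_def using d(1)[OF r] by simp
  qed
  moreover have "h 0 = 1" by (simp add: h_def 0)
  ultimately have "is_solution lam mu1 n L h"
    using dh0 unfolding is_solution_def m_def by blast
  thus ?thesis by (simp add: h_def[abs_def])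
qed

text \<open>The two smoothness conditions provide unrelated derivative functions, f1 and f2 inside
  and h1 up to 0. They are matched by uniqueness of derivatives, with each other, with
  \<open>deriv\<close> and, at 0, with \<open>mu1\<close>. The continuity of h1 up to 0 then gives
  that of z.\<close>

lemma is_solution_imp_profile:
  assumes sol: "is_solution lam mu1 n L h" and "L > 0"
  obtains z where "profile (of_int n - 1) (- lam) (mu1 / 2) L (\<lambda>r. sqrt (h r)) z"
proof -
  define m where "m = real_of_int n - 1"
  from sol obtain f1 f2 where f: "\<And>r. r \<in> {0<..<L} \<Longrightarrow> (h has_real_derivative f1 r) (at r within {0<..<L})"
      "\<And>r. r \<in> {0<..<L} \<Longrightarrow> (f1 has_real_derivative f2 r) (at r within {0<..<L})"
    unfolding is_solution_def numeral_2_eq_2 Ck_on.simps by blast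
  from sol obtain h1 where h1: "\<And>r. r \<in> {0..<L} \<Longrightarrow> (h has_real_derivative h1 r) (at r within {0..<L})"
      "continuous_on {0..<L} h1"
    unfolding is_solution_def One_nat_def Ck_on.simps by blast
  have h0: "h 0 = 1" "(h has_real_derivative mu1) (at 0 within {0..<L})"
    using sol unfolding is_solution_def by auto
  have ode: "2 * r\<^sup>2 * h r * deriv (deriv h) r =
      m * h r * (h r - 1) + r * deriv h r * (r * deriv h r - lam * r - m)" "h r > 0"
    if "r \<in> {0<..<L}" for r using sol that unfolding is_solution_def m_def by auto
  have d1: "(h has_real_derivative f1 r) (at r)" "(f1 has_real_derivative f2 r) (at r)"
    if "r \<in> {0<..<L}" for r using f[OF that] unfolding at_within_open[OF that open_greaterThanLessThan] by auto
  have h1f1: "h1 r = f1 r" if r: "r \<in> {0<..<L}" for r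
  proof -
    have "(h has_real_derivative h1 r) (at r within {0<..<L})"
      using h1(1)[of r] r by (auto intro: has_field_derivative_subset)
    hence "(h has_real_derivative h1 r) (at r)"
      unfolding at_within_open[OF r open_greaterThanLessThan] .
    thus ?thesis using d1(1)[OF r] DERIV_unique by blast
  qed
  have dh: "(h has_real_derivative h1 r) (at r)" if "r \<in> {0<..<L}" for r
    using d1(1)[OF that] h1f1[OF that] by simp
  have dh1: "(h1 has_real_derivative f2 r) (at r)" if "r \<in> {0<..<L}" for r
    by (rule has_field_derivative_transform_within_open[OF d1(2)[OF that], of "{0<..<L}"])
      (use h1f1 that in auto)
  have deriv: "deriv h r = h1 r" "deriv (deriv h) r = f2 r" if r: "r \<in> {0<..<L}" for r
  proof -
    have 1: "deriv h s = h1 s" if "s \<in> {0<..<L}" for s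
      by (rule DERIV_imp_deriv[OF dh[OF that]])
    show "deriv h r = h1 r" by (rule 1[OF r])
    have "(deriv h has_real_derivative f2 r) (at r)"
      by (rule has_field_derivative_transform_within_open[OF dh1[OF r], of "{0<..<L}"])
        (use 1 r in auto)
    thus "deriv (deriv h) r = f2 r" by (rule DERIV_imp_deriv)
  qed
  have h10: "h1 0 = mu1"
  proof -
    have "at 0 within {0..<L} = at 0 within {0..L}"
      by (rule at_within_nhd[of 0 "{..<L}"]) (use \<open>L > 0\<close> in auto)
    \<comment> \<open>Nontriviality of this filter is what makes the one-sided derivative at 0
      unique.\<close>
    hence "at 0 within {0..<L} \<noteq> bot" using \<open>L > 0\<close> by (simp add: at_within_Icc_at_right)
    moreover have "((\<lambda>r. (h r - h 0) / (r - 0)) \<longlongrightarrow> h1 0) (at 0 within {0..<L})"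
      "((\<lambda>r. (h r - h 0) / (r - 0)) \<longlongrightarrow> mu1) (at 0 within {0..<L})"
      using h1(1)[of 0] h0(2) \<open>L > 0\<close> by (simp_all add: has_field_derivative_iff)
    ultimately show ?thesis using tendsto_unique by blast
  qed
  have ch: "continuous_on {0..<L} h" using h1(1) DERIV_continuous_on by blast
  have hpos: "h r > 0" if "r \<in> {0..<L}" for r
    using ode(2)[of r] h0(1) that by (cases "r = 0") auto
  define y where "y r = sqrt (h r)" for r
  define z where "z r = h1 r / (2 * y r)" for r
  have y: "y r > 0" "(y r)\<^sup>2 = h r" if "r \<in> {0..<L}" for r
    using hpos[OF that] by (simp_all add: y_def)
  have dy: "(y has_real_derivative z r) (at r)" if r: "r \<in> {0<..<L}" for r
    unfolding y_def z_def using hpos[of r] r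
    by (auto intro!: derivative_eq_intros dh simp: field_simps)
  have "profile m (- lam) (mu1 / 2) L y z"
    unfolding profile_def
  proof (intro conjI ballI)
    show "y 0 = 1" "z 0 = mu1 / 2" by (simp_all add: y_def z_def h0 h10)
    show cy: "continuous_on {0..<L} y" unfolding y_def by (intro continuous_intros ch)
    have "\<forall>r\<in>{0..<L}. y r \<noteq> 0" using y(1) by force
    thus "continuous_on {0..<L} z" unfolding z_def by (intro continuous_intros cy h1(2)) auto
    fix r assume r: "r \<in> {0<..<L}"
    hence r': "r \<in> {0..<L}" "r > 0" by auto
    show "y r > 0" using y r' by simp
    show "(y has_real_derivative z r) (at r)" by (rule dy[OF r])
    have hz: "h1 r = 2 * y r * z r" using y(1)[OF r'(1)] by (simp add: z_def)
    have "(z has_real_derivative (f2 r * (2 * y r) - h1 r * (2 * z r)) / (2 * y r * (2 * y r))) (at r)"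
      unfolding z_def
      by (rule derivative_eq_intros dh1[OF r] dy[OF r] refl | use y(1)[OF r'(1)] in \<open>simp add: z_def\<close>)+
    moreover have "(f2 r * (2 * y r) - h1 r * (2 * z r)) / (2 * y r * (2 * y r)) =
        accel m (- lam) r (y r) (z r)"
    proof -
      have "2 * r\<^sup>2 * (y r)\<^sup>2 * f2 r = m * (y r)\<^sup>2 * ((y r)\<^sup>2 - 1)
          + r * (2 * y r * z r) * (r * (2 * y r * z r) - lam * r - m)"
        using ode(1)[OF r] y(2)[OF r'(1)] by (simp add: deriv[OF r] hz)
      hence f2: "f2 r = (m * (y r)\<^sup>2 * ((y r)\<^sup>2 - 1)
          + r * (2 * y r * z r) * (r * (2 * y r * z r) - lam * r - m)) / (2 * r\<^sup>2 * (y r)\<^sup>2)"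
        using y(1)[OF r'(1)] r' by (simp add: eq_divide_eq mult_ac)
      show ?thesis unfolding accel_def hz f2
        using y(1)[OF r'(1)] r' by (simp add: field_simps power2_eq_square)
    qed
    ultimately show "(z has_real_derivative accel m (- lam) r (y r) (z r)) (at r)" by simp
  qed
  thus thesis using that by (simp add: m_def y_def[abs_def])
qed

theorem theorem1p3:
  fixes lam mu1 :: real and n :: int
  assumes "lam < 0" and "2 \<le> n" and "n \<le> 4"
  shows "\<exists>L::real. L \<ge> - (of_int n - 1) / lam \<and>
           (\<exists>h. is_solution lam mu1 n L h \<and>
                (\<forall>g. is_solution lam mu1 n L g \<longrightarrow> (\<forall>r\<in>{0..<L}. g r = h r)))"
proof -
  \<comment> \<open>This is m / k, so the required lower bound on L is attained with
    equality.\<close>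
  define L where "L = (real_of_int n - 1) / (- lam)"
  have m: "real_of_int n - 1 > 0" using assms by simp
  hence "L > 0" using assms by (simp add: L_def divide_pos_neg)
  obtain y z where prof: "profile (of_int n - 1) (- lam) (mu1 / 2) L y z"
    using profile_exists_max[OF m, of "- lam" "mu1 / 2"] assms unfolding L_def by auto
  have "g r = (y r)\<^sup>2" if g: "is_solution lam mu1 n L g" and r: "r \<in> {0..<L}" for g r
  proof -
    obtain v where v: "profile (of_int n - 1) (- lam) (mu1 / 2) L (\<lambda>r. sqrt (g r)) v"
      using is_solution_imp_profile[OF g \<open>L > 0\<close>] .
    have "sqrt (g r) = y r" using profile_unique(1)[OF v prof m r] .
    \<comment> \<open>Positivity makes the square root reversible, so uniqueness for y gives
      uniqueness for the original function.\<close>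
    moreover have "g r \<ge> 0" using g r unfolding is_solution_def by (cases "r = 0") (auto intro: less_imp_le)
    ultimately show ?thesis by (metis real_sqrt_pow2)
  qed
  moreover have "L \<ge> - (of_int n - 1) / lam"
    unfolding L_def using minus_divide_left minus_divide_right by (metis order_refl)
  ultimately show ?thesis using is_solution_square[OF prof \<open>L > 0\<close>] by blast
qed

end
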